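(* Let $\Gamma$ be a countable group and let $\Gamma_0$ be an abelian subgroup of $\Gamma$. The following two conditions are equivalent: (1) (SS) For every finite subset $C\subset\Gamma\setminus\Gamma_0$, there exists $\gamma\in\Gamma_0$ such that $g\gamma h\notin\Gamma_0$ for all $g,h\in C$. (2) (WM) $A=L(\Gamma_0)$ is weakly mixing in $M=L(\Gamma)$.
   Context: For a countable group $\Gamma$, $\lambda$ is the left regular representation on $\ell^2(\Gamma)$, $(\lambda(g)\xi)(h)=\xi(g^{-1}h)$, and $L(\Gamma)$ is the von Neumann algebra generated by $\lambda(\Gamma)$, equipped with the faithful normal trace $\tau(x)=\langle x\delta_1,\delta_1\rangle$ and the norm $\|x\|_2=\tau(x^*x)^{1/2}$. For a subgroup $\Gamma_0\subset\Gamma$, $L(\Gamma_0)$ is identified with the von Neumann subalgebra of $L(\Gamma)$ generated by $\lambda(\Gamma_0)$. For a unital von Neumann subalgebra $A$ of a finite von Neumann algebra $M$ with trace $\tau$, $E_A$ denotes the $\tau$-preserving conditional expectation of $M$ onto $A$, and $M\ominus A=\{x\in M: E_A(x)=0\}$. $U(A)$ is the unitary group of $A$. An abelian unital von Neumann subalgebra $A\subset M$ is called weakly mixing in $M$ if there exists a subgroup $G$ of $U(A)$ such that the action $\sigma$ of $G$ on $M$ by conjugation, $\sigma_v(x)=vxv^*$, is weakly mixing relative to $A$: for every finite set $F\subset M\ominus A$ and every $\varepsilon>0$ there exists $v\in G$ such that $\|E_A(x^*\sigma_v(y))\|_2\le\varepsilon$ for all $x,y\in F$. *)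

theory Defs
  imports "HOL-Analysis.Analysis" "HOL-Algebra.Group"
begin

section \<open>The Hilbert space of square-summable functions on a set\<close>

text \<open>Vectors are total functions that vanish outside the index set \<open>X\<close>; the inner
  product is linear in its first argument.\<close>

definition ell2 :: "'a set \<Rightarrow> ('a \<Rightarrow> complex) set" where
  "ell2 X = {\<xi>. (\<forall>x. x \<notin> X \<longrightarrow> \<xi> x = 0) \<and> (\<lambda>x. (cmod (\<xi> x))\<^sup>2) summable_on X}"

definition ell2_inner :: "'a set \<Rightarrow> ('a \<Rightarrow> complex) \<Rightarrow> ('a \<Rightarrow> complex) \<Rightarrow> complex" where
  "ell2_inner X \<xi> \<eta> = (\<Sum>\<^sub>\<infinity>x\<in>X. \<xi> x * cnj (\<eta> x))"

definition ell2_norm :: "'a set \<Rightarrow> ('a \<Rightarrow> complex) \<Rightarrow> real" where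
  "ell2_norm X \<xi> = sqrt (\<Sum>\<^sub>\<infinity>x\<in>X. (cmod (\<xi> x))\<^sup>2)"

definition delta :: "'a \<Rightarrow> 'a \<Rightarrow> complex" where
  "delta a = (\<lambda>x. if x = a then 1 else 0)"


section \<open>Bounded operators\<close>

type_synonym 'a operator = "('a \<Rightarrow> complex) \<Rightarrow> ('a \<Rightarrow> complex)"

text \<open>Operators are total functions set to zero off \<open>ell2 X\<close>, so that equality of
  operators is equality of functions and the product of operators is composition.\<close>

definition op_add :: "'a operator \<Rightarrow> 'a operator \<Rightarrow> 'a operator" where
  "op_add S T = (\<lambda>\<xi> x. S \<xi> x + T \<xi> x)"

definition op_scale :: "complex \<Rightarrow> 'a operator \<Rightarrow> 'a operator" where
  "op_scale c T = (\<lambda>\<xi> x. c * T \<xi> x)"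

definition op_zero :: "'a operator" where
  "op_zero = (\<lambda>\<xi> x. 0)"

definition op_id :: "'a set \<Rightarrow> 'a operator" where
  "op_id X = (\<lambda>\<xi>. if \<xi> \<in> ell2 X then \<xi> else (\<lambda>x. 0))"

definition bounded_ops :: "'a set \<Rightarrow> 'a operator set" where
  "bounded_ops X = {T.
     (\<forall>\<xi>\<in>ell2 X. T \<xi> \<in> ell2 X) \<and>
     (\<forall>\<xi>\<in>ell2 X. \<forall>\<eta>\<in>ell2 X. T (\<lambda>x. \<xi> x + \<eta> x) = (\<lambda>x. T \<xi> x + T \<eta> x)) \<and>
     (\<forall>c. \<forall>\<xi>\<in>ell2 X. T (\<lambda>x. c * \<xi> x) = (\<lambda>x. c * T \<xi> x)) \<and>
     (\<exists>K. \<forall>\<xi>\<in>ell2 X. ell2_norm X (T \<xi>) \<le> K * ell2_norm X \<xi>) \<and>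
     (\<forall>\<xi>. \<xi> \<notin> ell2 X \<longrightarrow> T \<xi> = (\<lambda>x. 0))}"

definition op_adj :: "'a set \<Rightarrow> 'a operator \<Rightarrow> 'a operator" where
  "op_adj X T = (THE S. S \<in> bounded_ops X \<and>
     (\<forall>\<xi>\<in>ell2 X. \<forall>\<eta>\<in>ell2 X. ell2_inner X (T \<xi>) \<eta> = ell2_inner X \<xi> (S \<eta>)))"

definition op_positive :: "'a set \<Rightarrow> 'a operator \<Rightarrow> bool" where
  "op_positive X T \<longleftrightarrow> (\<forall>\<xi>\<in>ell2 X. ell2_inner X (T \<xi>) \<xi> \<in> \<real>\<^sub>\<ge>\<^sub>0)"


section \<open>Von Neumann algebras\<close>

definition commutant :: "'a set \<Rightarrow> 'a operator set \<Rightarrow> 'a operator set" where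
  "commutant X N = {T \<in> bounded_ops X. \<forall>S\<in>N. T \<circ> S = S \<circ> T}"

text \<open>A self-adjoint set of bounded operators equal to its bicommutant; being a commutant,
  it is automatically a subalgebra containing the identity operator.\<close>

definition von_neumann_algebra :: "'a set \<Rightarrow> 'a operator set \<Rightarrow> bool" where
  "von_neumann_algebra X N \<longleftrightarrow>
     N \<subseteq> bounded_ops X \<and> (\<forall>T\<in>N. op_adj X T \<in> N) \<and> commutant X (commutant X N) = N"

definition vn_generated :: "'a set \<Rightarrow> 'a operator set \<Rightarrow> 'a operator set" where
  "vn_generated X S = \<Inter>{N. von_neumann_algebra X N \<and> S \<subseteq> N}"

definition unitary_group :: "'a set \<Rightarrow> 'a operator set \<Rightarrow> 'a operator monoid" where
  "unitary_group X A =
     \<lparr>carrier = {u \<in> A. op_adj X u \<circ> u = op_id X \<and> u \<circ> op_adj X u = op_id X},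
      mult = (\<circ>), one = op_id X\<rparr>"

text \<open>In the following, \<open>M\<close> is a von Neumann algebra with trace \<open>tr\<close> and \<open>A\<close> is a
  von Neumann subalgebra of \<open>M\<close>.\<close>

definition trace_norm2 ::
  "'a set \<Rightarrow> ('a operator \<Rightarrow> complex) \<Rightarrow> 'a operator \<Rightarrow> real" where
  "trace_norm2 X tr x = sqrt (Re (tr (op_adj X x \<circ> x)))"

definition is_cond_exp ::
  "'a set \<Rightarrow> ('a operator \<Rightarrow> complex) \<Rightarrow> 'a operator set \<Rightarrow> 'a operator set \<Rightarrow>
   ('a operator \<Rightarrow> 'a operator) \<Rightarrow> bool" where
  "is_cond_exp X tr M A E \<longleftrightarrow>
     E \<in> M \<rightarrow>\<^sub>E A \<and>
     (\<forall>x\<in>M. \<forall>y\<in>M. E (op_add x y) = op_add (E x) (E y)) \<and>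
     (\<forall>c. \<forall>x\<in>M. E (op_scale c x) = op_scale c (E x)) \<and>
     (\<forall>x\<in>M. op_positive X x \<longrightarrow> op_positive X (E x)) \<and>
     (\<forall>a\<in>A. E a = a) \<and>
     (\<forall>a\<in>A. \<forall>b\<in>A. \<forall>x\<in>M. E (a \<circ> x \<circ> b) = a \<circ> E x \<circ> b) \<and>
     (\<forall>x\<in>M. tr (E x) = tr x)"

text \<open>For a faithful trace there is at most one trace-preserving conditional expectation;
  for a faithful normal trace it exists.\<close>

definition cond_exp ::
  "'a set \<Rightarrow> ('a operator \<Rightarrow> complex) \<Rightarrow> 'a operator set \<Rightarrow> 'a operator set \<Rightarrow>
   'a operator \<Rightarrow> 'a operator" where
  "cond_exp X tr M A = (THE E. is_cond_exp X tr M A E)"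

definition cond_exp_kernel ::
  "'a set \<Rightarrow> ('a operator \<Rightarrow> complex) \<Rightarrow> 'a operator set \<Rightarrow> 'a operator set \<Rightarrow>
   'a operator set" where
  "cond_exp_kernel X tr M A = {x \<in> M. cond_exp X tr M A x = op_zero}"

definition conj_action :: "'a set \<Rightarrow> 'a operator \<Rightarrow> 'a operator \<Rightarrow> 'a operator" where
  "conj_action X v x = v \<circ> x \<circ> op_adj X v"

definition weakly_mixing_action ::
  "'a set \<Rightarrow> ('a operator \<Rightarrow> complex) \<Rightarrow> 'a operator set \<Rightarrow> 'a operator set \<Rightarrow>
   'a operator set \<Rightarrow> bool" where
  "weakly_mixing_action X tr M A G \<longleftrightarrow>
     (\<forall>F \<epsilon>. finite F \<and> F \<subseteq> cond_exp_kernel X tr M A \<and> \<epsilon> > 0 \<longrightarrow>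
        (\<exists>v\<in>G. \<forall>x\<in>F. \<forall>y\<in>F.
           trace_norm2 X tr (cond_exp X tr M A (op_adj X x \<circ> conj_action X v y)) \<le> \<epsilon>))"

definition weakly_mixing ::
  "'a set \<Rightarrow> ('a operator \<Rightarrow> complex) \<Rightarrow> 'a operator set \<Rightarrow> 'a operator set \<Rightarrow> bool" where
  "weakly_mixing X tr M A \<longleftrightarrow>
     von_neumann_algebra X M \<and> von_neumann_algebra X A \<and> A \<subseteq> M \<and>
     (\<forall>a\<in>A. \<forall>b\<in>A. a \<circ> b = b \<circ> a) \<and>
     (\<exists>G. subgroup G (unitary_group X A) \<and> weakly_mixing_action X tr M A G)"


section \<open>Group von Neumann algebras\<close>

definition left_regular :: "('a, 'b) monoid_scheme \<Rightarrow> 'a \<Rightarrow> 'a operator" where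
  "left_regular \<Gamma> g = (\<lambda>\<xi>. if \<xi> \<in> ell2 (carrier \<Gamma>)
     then (\<lambda>h. if h \<in> carrier \<Gamma> then \<xi> (inv\<^bsub>\<Gamma>\<^esub> g \<otimes>\<^bsub>\<Gamma>\<^esub> h) else 0)
     else (\<lambda>h. 0))"

text \<open>For a subgroup \<open>H\<close> of \<open>\<Gamma>\<close>, the von Neumann algebra of \<open>H\<close> acting on the
  square-summable functions on all of \<open>\<Gamma>\<close>; the case \<open>H = carrier \<Gamma>\<close> is the
  von Neumann algebra of \<open>\<Gamma>\<close> itself.\<close>

definition group_vna :: "('a, 'b) monoid_scheme \<Rightarrow> 'a set \<Rightarrow> 'a operator set" where
  "group_vna \<Gamma> H = vn_generated (carrier \<Gamma>) (left_regular \<Gamma> ` H)"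

definition group_trace :: "('a, 'b) monoid_scheme \<Rightarrow> 'a operator \<Rightarrow> complex" where
  "group_trace \<Gamma> x =
     ell2_inner (carrier \<Gamma>) (x (delta \<one>\<^bsub>\<Gamma>\<^esub>)) (delta \<one>\<^bsub>\<Gamma>\<^esub>)"

definition condition_SS :: "('a, 'b) monoid_scheme \<Rightarrow> 'a set \<Rightarrow> bool" where
  "condition_SS \<Gamma> H \<longleftrightarrow>
     (\<forall>C. finite C \<and> C \<subseteq> carrier \<Gamma> - H \<longrightarrow>
        (\<exists>\<gamma>\<in>H. \<forall>g\<in>C. \<forall>h\<in>C. g \<otimes>\<^bsub>\<Gamma>\<^esub> \<gamma> \<otimes>\<^bsub>\<Gamma>\<^esub> h \<notin> H))"

end

theory Submission
  imports Defs "HOL-Algebra.Coset"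
begin

text \<open>Write \<open>T(s,t)\<close> for the matrix coefficient \<open>T (delta t) s\<close> and \<open>\<lambda>(g)\<close> for
\<open>left_regular \<Gamma> g\<close>. For a subgroup \<open>H\<close>, the algebra \<open>group_vna \<Gamma> H\<close> consists of the bounded
operators whose matrix is invariant under right translation, \<open>T(sg,tg) = T(s,t)\<close>, and vanishes
unless \<open>s t\<inverse> \<in> H\<close> (lemma \<open>group_vna_iff\<close>). Such an operator is determined by the vector
\<open>T \<delta>\<^sub>1\<close>, and the trace-preserving conditional expectation onto \<open>group_vna \<Gamma> H\<close> erases the
matrix entries with \<open>s t\<inverse> \<notin> H\<close>. This erasure is the restriction to the diagonal blocks given by
the right cosets of \<open>H\<close>; this is why it is bounded, positive and a bimodule map
(\<open>cond_exp_eq_coset_pinching\<close>). On vectors it multiplies \<open>T \<delta>\<^sub>1\<close> by the indicator function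
of \<open>H\<close>.

Let now \<open>H\<close> be abelian, \<open>x\<close> and \<open>y\<close> in \<open>group_vna \<Gamma> (carrier \<Gamma>)\<close> and \<open>v\<close> a unitary of
\<open>group_vna \<Gamma> H\<close>. In \<open>E(x\<^sup>* v y v\<^sup>*)\<close> the last factor can be pulled out and moved to the left, where,
being isometric, it does not change the norm. So the quantity in the definition of weak mixing is
the norm of the restriction to \<open>H\<close> of the vector \<open>x\<^sup>* v y \<delta>\<^sub>1\<close> (\<open>mixing_norm_eq\<close>).

From the combinatorial condition to weak mixing, take the unitaries \<open>\<lambda>(\<gamma>)\<close>. The vectors \<open>x \<delta>\<^sub>1\<close>
and \<open>y \<delta>\<^sub>1\<close> vanish on \<open>H\<close>, so up to small errors they live on finite sets \<open>D\<close> and \<open>C\<close> disjoint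
from \<open>H\<close>. The restriction of \<open>x\<^sup>* \<lambda>(\<gamma>) \<delta>\<^sub>g\<close> to \<open>H\<close> only involves the values of \<open>x \<delta>\<^sub>1\<close> on
\<open>\<gamma> g H\<close>, and the condition applied to \<open>C \<union> D\<inverse>\<close> provides a \<open>\<gamma>\<close> for which \<open>\<gamma> g H\<close> misses \<open>D\<close> for
every \<open>g \<in> C\<close> (\<open>SS_imp_weakly_mixing_action\<close>).

Conversely, suppose a finite set \<open>C\<close> violates the condition. For \<open>x = \<lambda>(g\<inverse>)\<close>, \<open>y = \<lambda>(h)\<close> and any
unitary \<open>v\<close> of \<open>group_vna \<Gamma> H\<close>, the quantity above is the norm of the unit vector \<open>v \<delta>\<^sub>1\<close> restricted
to the set of \<open>\<gamma>\<close> with \<open>g \<gamma> h \<in> H\<close>. The finitely many such sets with \<open>g, h \<in> C\<close> cover \<open>H\<close>, which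
supports \<open>v \<delta>\<^sub>1\<close>, so these norms cannot all be small (\<open>weakly_mixing_action_imp_SS\<close>).\<close>

section \<open>Square-summable functions\<close>

definition cutoff :: "'a set \<Rightarrow> ('a \<Rightarrow> complex) \<Rightarrow> ('a \<Rightarrow> complex)" where
  "cutoff S \<xi> = (\<lambda>x. if x \<in> S then \<xi> x else 0)"

lemma ell2_zero_off: "\<xi> \<in> ell2 X \<Longrightarrow> x \<notin> X \<Longrightarrow> \<xi> x = 0"
  by (simp add: ell2_def)

lemma ell2_norm_nonneg [simp]: "0 \<le> ell2_norm X \<xi>"
  by (simp add: ell2_norm_def infsum_nonneg)

lemma L2_set_le_ell2_norm:
  assumes "\<xi> \<in> ell2 X" "F \<subseteq> X"
  shows "L2_set (\<lambda>x. cmod (\<xi> x)) F \<le> ell2_norm X \<xi>"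
proof (cases "finite F")
  case True
  have "(\<Sum>x\<in>F. (cmod (\<xi> x))\<^sup>2) \<le> (\<Sum>\<^sub>\<infinity>x\<in>X. (cmod (\<xi> x))\<^sup>2)"
    using assms True by (intro finite_sum_le_infsum) (auto simp: ell2_def)
  then show ?thesis
    by (simp add: L2_set_def ell2_norm_def)
qed simp

text \<open>Finite sections control membership and norm, so that the inequalities of Minkowski and
Cauchy--Schwarz carry over from \<^const>\<open>L2_set\<close>.\<close>

lemma ell2_boundedI:
  assumes off: "\<And>x. x \<notin> X \<Longrightarrow> \<xi> x = 0"
    and bound: "\<And>F. finite F \<Longrightarrow> F \<subseteq> X \<Longrightarrow> L2_set (\<lambda>x. cmod (\<xi> x)) F \<le> B"
  shows "\<xi> \<in> ell2 X" and "ell2_norm X \<xi> \<le> B"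
proof -
  have B: "0 \<le> B"
    using bound[of "{}"] by simp
  have le: "(\<Sum>x\<in>F. (cmod (\<xi> x))\<^sup>2) \<le> B\<^sup>2" if "finite F" "F \<subseteq> X" for F
    using bound[OF that] by (auto simp: L2_set_def dest: sqrt_le_D)
  have summ: "(\<lambda>x. (cmod (\<xi> x))\<^sup>2) summable_on X"
    by (rule nonneg_bdd_above_summable_on) (auto intro!: bdd_aboveI2 le)
  then show "\<xi> \<in> ell2 X"
    using off by (simp add: ell2_def)
  have "(\<Sum>\<^sub>\<infinity>x\<in>X. (cmod (\<xi> x))\<^sup>2) \<le> B\<^sup>2"
    using summ le by (rule infsum_le_finite_sums)
  then show "ell2_norm X \<xi> \<le> B"
    using B by (simp add: ell2_norm_def real_le_lsqrt)
qed

lemma ell2_norm_sq: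
  "(ell2_norm X \<xi>)\<^sup>2 = (\<Sum>\<^sub>\<infinity>x\<in>X. (cmod (\<xi> x))\<^sup>2)"
  by (simp add: ell2_norm_def infsum_nonneg)

lemma ell2_zero [simp]: "(\<lambda>x. 0) \<in> ell2 X"
  by (simp add: ell2_def)

lemma ell2_add:
  assumes "\<xi> \<in> ell2 X" "\<eta> \<in> ell2 X"
  shows ell2_add_closed: "(\<lambda>x. \<xi> x + \<eta> x) \<in> ell2 X"
    and ell2_norm_triangle: "ell2_norm X (\<lambda>x. \<xi> x + \<eta> x) \<le> ell2_norm X \<xi> + ell2_norm X \<eta>"
proof -
  have bound: "L2_set (\<lambda>x. cmod (\<xi> x + \<eta> x)) F \<le> ell2_norm X \<xi> + ell2_norm X \<eta>"
    if "F \<subseteq> X" for F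
  proof -
    have "L2_set (\<lambda>x. cmod (\<xi> x + \<eta> x)) F \<le> L2_set (\<lambda>x. cmod (\<xi> x) + cmod (\<eta> x)) F"
      by (rule L2_set_mono) (auto intro: norm_triangle_ineq)
    also have "\<dots> \<le> L2_set (\<lambda>x. cmod (\<xi> x)) F + L2_set (\<lambda>x. cmod (\<eta> x)) F"
      by (rule L2_set_triangle_ineq)
    also have "\<dots> \<le> ell2_norm X \<xi> + ell2_norm X \<eta>"
      by (intro add_mono L2_set_le_ell2_norm assms that)
    finally show ?thesis .
  qed
  show "(\<lambda>x. \<xi> x + \<eta> x) \<in> ell2 X"
    using assms bound by (intro ell2_boundedI(1)) (auto simp: ell2_zero_off)
  show "ell2_norm X (\<lambda>x. \<xi> x + \<eta> x) \<le> ell2_norm X \<xi> + ell2_norm X \<eta>"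
    using assms bound by (intro ell2_boundedI(2)) (auto simp: ell2_zero_off)
qed

lemma ell2_norm_scale: "ell2_norm X (\<lambda>x. c * \<xi> x) = cmod c * ell2_norm X \<xi>"
  by (simp add: ell2_norm_def norm_mult power_mult_distrib infsum_cmult_right' real_sqrt_mult)

lemma ell2_scale_closed: "\<xi> \<in> ell2 X \<Longrightarrow> (\<lambda>x. c * \<xi> x) \<in> ell2 X"
  by (auto simp: ell2_def norm_mult power_mult_distrib intro: summable_on_cmult_right)

lemma ell2_sum_closed:
  "(\<And>i. i \<in> I \<Longrightarrow> \<xi> i \<in> ell2 X) \<Longrightarrow> (\<lambda>x. \<Sum>i\<in>I. \<xi> i x) \<in> ell2 X"
proof (induction I rule: infinite_finite_induct)
  case (insert i I)
  then show ?case by (auto intro!: ell2_add_closed)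
qed auto

lemma ell2_norm_sum_le:
  "(\<And>i. i \<in> I \<Longrightarrow> \<xi> i \<in> ell2 X) \<Longrightarrow>
    ell2_norm X (\<lambda>x. \<Sum>i\<in>I. \<xi> i x) \<le> (\<Sum>i\<in>I. ell2_norm X (\<xi> i))"
proof (induction I rule: infinite_finite_induct)
  case (insert i I)
  have "ell2_norm X (\<lambda>x. \<xi> i x + (\<Sum>i\<in>I. \<xi> i x))
      \<le> ell2_norm X (\<xi> i) + ell2_norm X (\<lambda>x. \<Sum>i\<in>I. \<xi> i x)"
    using insert.prems by (intro ell2_norm_triangle ell2_sum_closed) auto
  also have "\<dots> \<le> ell2_norm X (\<xi> i) + (\<Sum>i\<in>I. ell2_norm X (\<xi> i))"
    using insert by auto
  finally show ?case
    using insert.hyps by simp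
qed (auto simp: ell2_norm_def)

lemma ell2_mono:
  assumes "\<xi> \<in> ell2 X" "\<And>x. cmod (\<eta> x) \<le> cmod (\<xi> x)"
  shows ell2_mono_closed: "\<eta> \<in> ell2 X" and ell2_norm_mono: "ell2_norm X \<eta> \<le> ell2_norm X \<xi>"
proof -
  have off: "\<eta> x = 0" if "x \<notin> X" for x
    using assms(2)[of x] ell2_zero_off[OF assms(1) that] by simp
  have bound: "L2_set (\<lambda>x. cmod (\<eta> x)) F \<le> ell2_norm X \<xi>" if "F \<subseteq> X" for F
    using L2_set_mono[of F "\<lambda>x. cmod (\<eta> x)" "\<lambda>x. cmod (\<xi> x)"]
      L2_set_le_ell2_norm[OF assms(1) that] assms(2) by auto
  show "\<eta> \<in> ell2 X" "ell2_norm X \<eta> \<le> ell2_norm X \<xi>"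
    using ell2_boundedI[of X \<eta> "ell2_norm X \<xi>"] off bound by auto
qed

lemma ell2_cutoff: "\<xi> \<in> ell2 X \<Longrightarrow> cutoff S \<xi> \<in> ell2 X"
  by (rule ell2_mono_closed) (auto simp: cutoff_def)

lemma ell2_norm_cutoff_le: "\<xi> \<in> ell2 X \<Longrightarrow> ell2_norm X (cutoff S \<xi>) \<le> ell2_norm X \<xi>"
  by (rule ell2_norm_mono) (auto simp: cutoff_def)

lemma ell2_norm_cutoff_sq: "(ell2_norm X (cutoff S \<xi>))\<^sup>2 = (\<Sum>\<^sub>\<infinity>x\<in>X \<inter> S. (cmod (\<xi> x))\<^sup>2)"
  unfolding ell2_norm_sq by (rule infsum_cong_neutral) (auto simp: cutoff_def)

lemma ell2_delta [simp]: "a \<in> X \<Longrightarrow> delta a \<in> ell2 X"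
  unfolding ell2_def delta_def
  by (auto intro!: finite_nonzero_values_imp_summable_on)

text \<open>Finitely supported vectors are dense.\<close>

lemma ell2_truncation:
  assumes "\<xi> \<in> ell2 X" "\<epsilon> > 0"
  obtains F where "finite F" "F \<subseteq> X" "ell2_norm X (cutoff (- F) \<xi>) \<le> \<epsilon>"
proof -
  have summ: "(\<lambda>x. (cmod (\<xi> x))\<^sup>2) summable_on X"
    using assms(1) by (simp add: ell2_def)
  obtain F where F: "finite F" "F \<subseteq> X"
    and near: "dist (\<Sum>x\<in>F. (cmod (\<xi> x))\<^sup>2) (\<Sum>\<^sub>\<infinity>x\<in>X. (cmod (\<xi> x))\<^sup>2) \<le> \<epsilon>\<^sup>2"
    using infsum_finite_approximation[OF summ, of "\<epsilon>\<^sup>2"] assms(2) by auto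
  have "(ell2_norm X (cutoff (- F) \<xi>))\<^sup>2
      = (\<Sum>\<^sub>\<infinity>x\<in>X. (cmod (\<xi> x))\<^sup>2) - (\<Sum>x\<in>F. (cmod (\<xi> x))\<^sup>2)"
    using infsum_Diff[OF summ _ F(2)] F
    by (simp add: ell2_norm_cutoff_sq Diff_eq)
  also have "\<dots> \<le> \<epsilon>\<^sup>2"
    using near by (simp add: dist_real_def)
  finally have "ell2_norm X (cutoff (- F) \<xi>) \<le> \<epsilon>"
    using assms(2) power2_le_imp_le by fastforce
  with F show ?thesis by (rule that)
qed

text \<open>Coordinates in \<open>S\<close> contribute nothing to vectors that vanish there, so the finite support of
the approximants can be kept away from \<open>S\<close>.\<close>

lemma finite_common_truncation:
  assumes "finite F" "F \<subseteq> ell2 X" "\<epsilon> > 0"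
    and vanish: "\<forall>\<xi>\<in>F. \<forall>h\<in>S. \<xi> h = 0"
  obtains D where "finite D" "D \<subseteq> X - S" "\<forall>\<xi>\<in>F. ell2_norm X (cutoff (- D) \<xi>) \<le> \<epsilon>"
proof -
  have "\<forall>\<xi>\<in>F. \<exists>D. finite D \<and> D \<subseteq> X \<and> ell2_norm X (cutoff (- D) \<xi>) \<le> \<epsilon>"
    by (meson assms(2,3) ell2_truncation subsetD)
  then obtain D where "\<forall>\<xi>\<in>F. finite (D \<xi>) \<and> D \<xi> \<subseteq> X \<and> ell2_norm X (cutoff (- D \<xi>) \<xi>) \<le> \<epsilon>"
    by (rule bchoice[THEN exE])
  then have D: "\<And>\<xi>. \<xi> \<in> F \<Longrightarrow> finite (D \<xi>)" "\<And>\<xi>. \<xi> \<in> F \<Longrightarrow> D \<xi> \<subseteq> X"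
    "\<And>\<xi>. \<xi> \<in> F \<Longrightarrow> ell2_norm X (cutoff (- D \<xi>) \<xi>) \<le> \<epsilon>"
    by simp_all
  have "ell2_norm X (cutoff (- (\<Union> (D ` F) - S)) \<xi>) \<le> \<epsilon>" if \<xi>: "\<xi> \<in> F" for \<xi>
  proof -
    have "ell2_norm X (cutoff (- (\<Union> (D ` F) - S)) \<xi>) \<le> ell2_norm X (cutoff (- D \<xi>) \<xi>)"
      using vanish \<xi> subsetD[OF assms(2) \<xi>]
      by (intro ell2_norm_mono ell2_cutoff) (auto simp: cutoff_def)
    also have "\<dots> \<le> \<epsilon>"
      by (rule D(3)[OF \<xi>])
    finally show ?thesis .
  qed
  moreover have "finite (\<Union> (D ` F) - S)" "\<Union> (D ` F) - S \<subseteq> X - S"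
    using D(1,2) assms(1) by auto
  ultimately show ?thesis
    using that by blast
qed

subsection \<open>The inner product\<close>

lemma ell2_inner_summable:
  assumes "\<xi> \<in> ell2 X" "\<eta> \<in> ell2 X"
  shows ell2_inner_abs_summable: "(\<lambda>x. cmod (\<xi> x * cnj (\<eta> x))) summable_on X"
    and ell2_inner_bound: "cmod (ell2_inner X \<xi> \<eta>) \<le> ell2_norm X \<xi> * ell2_norm X \<eta>"
proof -
  have le: "(\<Sum>x\<in>F. cmod (\<xi> x * cnj (\<eta> x))) \<le> ell2_norm X \<xi> * ell2_norm X \<eta>"
    if "finite F" "F \<subseteq> X" for F
  proof -
    have "(\<Sum>x\<in>F. cmod (\<xi> x * cnj (\<eta> x))) = (\<Sum>x\<in>F. \<bar>cmod (\<xi> x)\<bar> * \<bar>cmod (\<eta> x)\<bar>)"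
      by (simp add: norm_mult)
    also have "\<dots> \<le> L2_set (\<lambda>x. cmod (\<xi> x)) F * L2_set (\<lambda>x. cmod (\<eta> x)) F"
      by (rule L2_set_mult_ineq)
    also have "\<dots> \<le> ell2_norm X \<xi> * ell2_norm X \<eta>"
      by (intro mult_mono L2_set_le_ell2_norm assms that) auto
    finally show ?thesis .
  qed
  show summ: "(\<lambda>x. cmod (\<xi> x * cnj (\<eta> x))) summable_on X"
    by (rule nonneg_bdd_above_summable_on) (auto intro!: bdd_aboveI2 le)
  have "cmod (ell2_inner X \<xi> \<eta>) \<le> (\<Sum>\<^sub>\<infinity>x\<in>X. cmod (\<xi> x * cnj (\<eta> x)))"
    unfolding ell2_inner_def using summ by (rule norm_infsum_bound)
  also have "\<dots> \<le> ell2_norm X \<xi> * ell2_norm X \<eta>"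
    using summ le by (rule infsum_le_finite_sums)
  finally show "cmod (ell2_inner X \<xi> \<eta>) \<le> ell2_norm X \<xi> * ell2_norm X \<eta>" .
qed

lemma ell2_inner_summable_on:
  "\<xi> \<in> ell2 X \<Longrightarrow> \<eta> \<in> ell2 X \<Longrightarrow> (\<lambda>x. \<xi> x * cnj (\<eta> x)) summable_on X"
  by (rule abs_summable_summable) (rule ell2_inner_abs_summable)

lemma ell2_inner_cnj: "cnj (ell2_inner X \<xi> \<eta>) = ell2_inner X \<eta> \<xi>"
  unfolding ell2_inner_def infsum_cnj[symmetric] by (simp add: mult.commute)

lemma ell2_inner_add_left:
  "\<xi> \<in> ell2 X \<Longrightarrow> \<xi>' \<in> ell2 X \<Longrightarrow> \<eta> \<in> ell2 X \<Longrightarrow>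
    ell2_inner X (\<lambda>x. \<xi> x + \<xi>' x) \<eta> = ell2_inner X \<xi> \<eta> + ell2_inner X \<xi>' \<eta>"
  by (simp add: ell2_inner_def distrib_right infsum_add ell2_inner_summable_on)

lemma ell2_inner_scale_left: "ell2_inner X (\<lambda>x. c * \<xi> x) \<eta> = c * ell2_inner X \<xi> \<eta>"
  by (simp add: ell2_inner_def mult.assoc infsum_cmult_right')

lemma ell2_inner_delta_right: "a \<in> X \<Longrightarrow> ell2_inner X \<xi> (delta a) = \<xi> a"
proof -
  assume a: "a \<in> X"
  have "ell2_inner X \<xi> (delta a) = (\<Sum>\<^sub>\<infinity>x\<in>{a}. \<xi> x)"
    unfolding ell2_inner_def using a by (intro infsum_cong_neutral) (auto simp: delta_def)
  then show ?thesis by simp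
qed

lemma ell2_inner_delta_left: "a \<in> X \<Longrightarrow> ell2_inner X (delta a) \<xi> = cnj (\<xi> a)"
  by (metis ell2_inner_cnj ell2_inner_delta_right)

lemma ell2_inner_self:
  assumes "\<xi> \<in> ell2 X"
  shows "ell2_inner X \<xi> \<xi> = of_real ((ell2_norm X \<xi>)\<^sup>2)"
proof -
  have "((\<lambda>x. (cmod (\<xi> x))\<^sup>2) has_sum (ell2_norm X \<xi>)\<^sup>2) X"
    using assms by (simp add: ell2_norm_sq ell2_def)
  then show ?thesis
    unfolding ell2_inner_def complex_norm_square[symmetric]
    by (intro infsumI has_sum_of_real)
qed

lemma cutoff_finite_eq_sum:
  assumes "finite F" shows "cutoff F \<xi> = (\<lambda>x. \<Sum>a\<in>F. \<xi> a * delta a x)"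
  using assms by (auto simp: cutoff_def delta_def fun_eq_iff if_distrib[of "(*) _"] cong: if_cong)

lemma cutoff_split: "\<xi> = (\<lambda>x. cutoff S \<xi> x + cutoff (- S) \<xi> x)"
  by (auto simp: cutoff_def)

section \<open>Bounded operators and their adjoints\<close>

lemma bounded_ops_closed: "T \<in> bounded_ops X \<Longrightarrow> \<xi> \<in> ell2 X \<Longrightarrow> T \<xi> \<in> ell2 X"
  by (simp add: bounded_ops_def)

lemma bounded_ops_add:
  "T \<in> bounded_ops X \<Longrightarrow> \<xi> \<in> ell2 X \<Longrightarrow> \<eta> \<in> ell2 X \<Longrightarrow> T (\<lambda>x. \<xi> x + \<eta> x) = (\<lambda>x. T \<xi> x + T \<eta> x)"
  by (simp add: bounded_ops_def)

lemma bounded_ops_scale: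
  "T \<in> bounded_ops X \<Longrightarrow> \<xi> \<in> ell2 X \<Longrightarrow> T (\<lambda>x. c * \<xi> x) = (\<lambda>x. c * T \<xi> x)"
  by (simp add: bounded_ops_def)

lemma bounded_ops_off: "T \<in> bounded_ops X \<Longrightarrow> \<xi> \<notin> ell2 X \<Longrightarrow> T \<xi> = (\<lambda>x. 0)"
  by (simp add: bounded_ops_def)

lemma bounded_ops_zero: "T \<in> bounded_ops X \<Longrightarrow> T (\<lambda>x. 0) = (\<lambda>x. 0)"
  using bounded_ops_scale[of T X "\<lambda>x. 0" 0] by simp

lemma bounded_ops_ell2: "T \<in> bounded_ops X \<Longrightarrow> T \<xi> \<in> ell2 X"
  by (cases "\<xi> \<in> ell2 X") (auto simp: bounded_ops_closed bounded_ops_off)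

lemma bounded_ops_bound:
  assumes "T \<in> bounded_ops X"
  obtains K where "K \<ge> 0" "\<And>\<xi>. \<xi> \<in> ell2 X \<Longrightarrow> ell2_norm X (T \<xi>) \<le> K * ell2_norm X \<xi>"
proof -
  obtain K where K: "\<forall>\<xi>\<in>ell2 X. ell2_norm X (T \<xi>) \<le> K * ell2_norm X \<xi>"
    using assms by (auto simp: bounded_ops_def)
  have "ell2_norm X (T \<xi>) \<le> \<bar>K\<bar> * ell2_norm X \<xi>" if "\<xi> \<in> ell2 X" for \<xi>
    using K that mult_right_mono[OF abs_ge_self[of K] ell2_norm_nonneg[of X \<xi>]] by fastforce
  with that[of "\<bar>K\<bar>"] show ?thesis by simp
qed

lemma finite_common_bound:
  assumes "finite F" "F \<subseteq> bounded_ops X"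
  obtains K where "K \<ge> 0"
    "\<forall>T\<in>F. \<forall>\<xi>\<in>ell2 X. ell2_norm X (T \<xi>) \<le> K * ell2_norm X \<xi>"
proof -
  have "\<forall>T\<in>F. \<exists>K\<ge>0. \<forall>\<xi>\<in>ell2 X. ell2_norm X (T \<xi>) \<le> K * ell2_norm X \<xi>"
    by (meson assms(2) bounded_ops_bound subsetD)
  then obtain K where "\<forall>T\<in>F. K T \<ge> 0 \<and> (\<forall>\<xi>\<in>ell2 X. ell2_norm X (T \<xi>) \<le> K T * ell2_norm X \<xi>)"
    by (rule bchoice[THEN exE])
  then have K: "\<And>T. T \<in> F \<Longrightarrow> K T \<ge> 0"
    "\<And>T \<xi>. T \<in> F \<Longrightarrow> \<xi> \<in> ell2 X \<Longrightarrow> ell2_norm X (T \<xi>) \<le> K T * ell2_norm X \<xi>"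
    by simp_all
  have "ell2_norm X (T \<xi>) \<le> sum K F * ell2_norm X \<xi>" if "T \<in> F" "\<xi> \<in> ell2 X" for T \<xi>
  proof -
    have "K T \<le> sum K F"
      using assms(1) K(1) that(1) by (intro member_le_sum) auto
    then show ?thesis
      using K(2)[OF that] mult_right_mono[of "K T" "sum K F" "ell2_norm X \<xi>"] by simp
  qed
  moreover have "sum K F \<ge> 0"
    using K(1) by (rule sum_nonneg)
  ultimately show ?thesis
    using that by blast
qed

lemma bounded_opsI:
  assumes "\<And>\<xi>. \<xi> \<in> ell2 X \<Longrightarrow> T \<xi> \<in> ell2 X"
    and "\<And>\<xi> \<eta>. \<xi> \<in> ell2 X \<Longrightarrow> \<eta> \<in> ell2 X \<Longrightarrow> T (\<lambda>x. \<xi> x + \<eta> x) = (\<lambda>x. T \<xi> x + T \<eta> x)"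
    and "\<And>c \<xi>. \<xi> \<in> ell2 X \<Longrightarrow> T (\<lambda>x. c * \<xi> x) = (\<lambda>x. c * T \<xi> x)"
    and "\<And>\<xi>. \<xi> \<in> ell2 X \<Longrightarrow> ell2_norm X (T \<xi>) \<le> K * ell2_norm X \<xi>"
    and "\<And>\<xi>. \<xi> \<notin> ell2 X \<Longrightarrow> T \<xi> = (\<lambda>x. 0)"
  shows "T \<in> bounded_ops X"
  using assms unfolding bounded_ops_def by blast

lemma bounded_ops_sum:
  assumes "T \<in> bounded_ops X"
  shows "(\<And>i. i \<in> I \<Longrightarrow> \<xi> i \<in> ell2 X) \<Longrightarrow>
    T (\<lambda>x. \<Sum>i\<in>I. c i * \<xi> i x) = (\<lambda>x. \<Sum>i\<in>I. c i * T (\<xi> i) x)"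
proof (induction I rule: infinite_finite_induct)
  case (insert i I)
  then show ?case
    by (simp add: bounded_ops_add[OF assms] bounded_ops_scale[OF assms]
        ell2_scale_closed ell2_sum_closed)
qed (auto simp: bounded_ops_zero[OF assms])

lemma bounded_ops_comp:
  assumes S: "S \<in> bounded_ops X" and T: "T \<in> bounded_ops X"
  shows "S \<circ> T \<in> bounded_ops X"
proof -
  obtain K where K: "K \<ge> 0" "\<And>\<xi>. \<xi> \<in> ell2 X \<Longrightarrow> ell2_norm X (S \<xi>) \<le> K * ell2_norm X \<xi>"
    using bounded_ops_bound[OF S] by blast
  obtain L where L: "L \<ge> 0" "\<And>\<xi>. \<xi> \<in> ell2 X \<Longrightarrow> ell2_norm X (T \<xi>) \<le> L * ell2_norm X \<xi>"
    using bounded_ops_bound[OF T] by blast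
  show ?thesis
  proof (rule bounded_opsI[where K = "K * L"])
    fix \<xi> assume \<xi>: "\<xi> \<in> ell2 X"
    have "ell2_norm X (S (T \<xi>)) \<le> K * ell2_norm X (T \<xi>)"
      by (intro K bounded_ops_closed[OF T] \<xi>)
    also have "\<dots> \<le> K * (L * ell2_norm X \<xi>)"
      by (intro mult_left_mono K L \<xi>)
    finally show "ell2_norm X ((S \<circ> T) \<xi>) \<le> K * L * ell2_norm X \<xi>"
      by (simp add: mult.assoc)
  qed (auto simp: bounded_ops_closed[OF S] bounded_ops_closed[OF T] bounded_ops_add[OF S]
      bounded_ops_add[OF T] bounded_ops_scale[OF S] bounded_ops_scale[OF T]
      bounded_ops_off[OF T] bounded_ops_zero[OF S])
qed

lemma bounded_ops_op_add:
  assumes S: "S \<in> bounded_ops X" and T: "T \<in> bounded_ops X"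
  shows "op_add S T \<in> bounded_ops X"
proof -
  obtain K where K: "K \<ge> 0" "\<And>\<xi>. \<xi> \<in> ell2 X \<Longrightarrow> ell2_norm X (S \<xi>) \<le> K * ell2_norm X \<xi>"
    using bounded_ops_bound[OF S] by blast
  obtain L where L: "L \<ge> 0" "\<And>\<xi>. \<xi> \<in> ell2 X \<Longrightarrow> ell2_norm X (T \<xi>) \<le> L * ell2_norm X \<xi>"
    using bounded_ops_bound[OF T] by blast
  show ?thesis
  proof (rule bounded_opsI[where K = "K + L"])
    fix \<xi> assume \<xi>: "\<xi> \<in> ell2 X"
    then show "op_add S T \<xi> \<in> ell2 X"
      by (simp add: op_add_def ell2_add_closed bounded_ops_closed[OF S] bounded_ops_closed[OF T])
    have "ell2_norm X (op_add S T \<xi>) \<le> ell2_norm X (S \<xi>) + ell2_norm X (T \<xi>)"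
      unfolding op_add_def
      by (intro ell2_norm_triangle bounded_ops_closed[OF S] bounded_ops_closed[OF T] \<xi>)
    also have "\<dots> \<le> (K + L) * ell2_norm X \<xi>"
      using K(2)[OF \<xi>] L(2)[OF \<xi>] by (simp add: distrib_right)
    finally show "ell2_norm X (op_add S T \<xi>) \<le> (K + L) * ell2_norm X \<xi>" .
  qed (auto simp: op_add_def bounded_ops_add[OF S] bounded_ops_add[OF T] bounded_ops_scale[OF S]
      bounded_ops_scale[OF T] bounded_ops_off[OF T] bounded_ops_off[OF S] algebra_simps)
qed

lemma bounded_ops_op_scale:
  assumes T: "T \<in> bounded_ops X"
  shows "op_scale c T \<in> bounded_ops X"
proof -
  obtain L where L: "L \<ge> 0" "\<And>\<xi>. \<xi> \<in> ell2 X \<Longrightarrow> ell2_norm X (T \<xi>) \<le> L * ell2_norm X \<xi>"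
    using bounded_ops_bound[OF T] by blast
  show ?thesis
  proof (rule bounded_opsI[where K = "cmod c * L"])
    fix \<xi> assume \<xi>: "\<xi> \<in> ell2 X"
    show "ell2_norm X (op_scale c T \<xi>) \<le> cmod c * L * ell2_norm X \<xi>"
      using mult_left_mono[OF L(2)[OF \<xi>] norm_ge_zero[of c]]
      by (simp add: op_scale_def ell2_norm_scale mult.assoc)
  qed (auto simp: op_scale_def ell2_scale_closed bounded_ops_closed[OF T] bounded_ops_add[OF T]
      bounded_ops_scale[OF T] bounded_ops_off[OF T] algebra_simps)
qed

lemma bounded_ops_id: "op_id X \<in> bounded_ops X"
  by (rule bounded_opsI[where K = 1]) (auto simp: op_id_def ell2_add_closed ell2_scale_closed)

lemma op_id_comp: "T \<in> bounded_ops X \<Longrightarrow> op_id X \<circ> T = T" "T \<in> bounded_ops X \<Longrightarrow> T \<circ> op_id X = T"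
  by (auto simp: op_id_def fun_eq_iff bounded_ops_ell2 bounded_ops_zero bounded_ops_off)

text \<open>The condition by which \<^const>\<open>op_adj\<close> selects the adjoint.\<close>

definition is_adj :: "'a set \<Rightarrow> 'a operator \<Rightarrow> 'a operator \<Rightarrow> bool" where
  "is_adj X T S \<longleftrightarrow> S \<in> bounded_ops X \<and>
     (\<forall>\<xi>\<in>ell2 X. \<forall>\<eta>\<in>ell2 X. ell2_inner X (T \<xi>) \<eta> = ell2_inner X \<xi> (S \<eta>))"

lemma is_adj_unique:
  assumes "is_adj X T S" "is_adj X T S'"
  shows "S = S'"
proof
  fix \<eta>
  have B: "S \<in> bounded_ops X" "S' \<in> bounded_ops X"
    using assms by (auto simp: is_adj_def)
  show "S \<eta> = S' \<eta>"
  proof (cases "\<eta> \<in> ell2 X")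
    case True
    show ?thesis
    proof
      fix x show "S \<eta> x = S' \<eta> x"
      proof (cases "x \<in> X")
        case True
        then have "cnj (S \<eta> x) = cnj (S' \<eta> x)"
          using assms \<open>\<eta> \<in> ell2 X\<close> unfolding is_adj_def
          by (simp flip: ell2_inner_delta_left)
        then show ?thesis by simp
      next
        case False
        then show ?thesis
          using B by (metis bounded_ops_ell2 ell2_zero_off)
      qed
    qed
  qed (simp add: bounded_ops_off[OF B(1)] bounded_ops_off[OF B(2)])
qed

lemma is_adj_op_adj: "is_adj X T S \<Longrightarrow> op_adj X T = S"
  unfolding op_adj_def is_adj_def[symmetric] by (blast intro: is_adj_unique)

lemma ell2_inner_sum_left:
  "(\<And>i. i \<in> I \<Longrightarrow> \<xi> i \<in> ell2 X) \<Longrightarrow> \<eta> \<in> ell2 X \<Longrightarrow>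
    ell2_inner X (\<lambda>x. \<Sum>i\<in>I. c i * \<xi> i x) \<eta> = (\<Sum>i\<in>I. c i * ell2_inner X (\<xi> i) \<eta>)"
proof (induction I rule: infinite_finite_induct)
  case (insert i I)
  then show ?case
    by (simp add: ell2_inner_add_left ell2_inner_scale_left ell2_scale_closed ell2_sum_closed)
qed (auto simp: ell2_inner_def)

text \<open>On coordinates the adjoint can only be \<open>S \<eta> x = \<langle>\<eta>, T \<delta>\<^sub>x\<rangle>\<close>. That \<open>S \<eta>\<close> is square-summable
follows by applying \<open>T\<close> to a finite section \<open>\<zeta>\<close> of \<open>S \<eta>\<close> itself: then
\<open>\<parallel>\<zeta>\<parallel>\<^sup>2 = \<langle>T \<zeta>, \<eta>\<rangle> \<le> K \<parallel>\<zeta>\<parallel> \<parallel>\<eta>\<parallel>\<close>. The adjunction identity is linear algebra for finitely supported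
vectors and extends to all vectors by density.\<close>

lemma adj_exists:
  assumes T: "T \<in> bounded_ops X"
  shows "\<exists>S. is_adj X T S"
proof -
  obtain K where K: "K \<ge> 0" "\<And>\<xi>. \<xi> \<in> ell2 X \<Longrightarrow> ell2_norm X (T \<xi>) \<le> K * ell2_norm X \<xi>"
    using bounded_ops_bound[OF T] by blast
  define S where "S = (\<lambda>\<eta> x. if \<eta> \<in> ell2 X \<and> x \<in> X then ell2_inner X \<eta> (T (delta x)) else 0)"
  have fin: "ell2_inner X (T (cutoff F \<xi>)) \<eta> = (\<Sum>x\<in>F. \<xi> x * cnj (S \<eta> x))"
    if "\<eta> \<in> ell2 X" "finite F" "F \<subseteq> X" for \<xi> \<eta> F
  proof -
    have d: "delta x \<in> ell2 X" "T (delta x) \<in> ell2 X" if "x \<in> F" for x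
      using that \<open>F \<subseteq> X\<close> bounded_ops_ell2[OF T] by auto
    have "ell2_inner X (T (cutoff F \<xi>)) \<eta> = (\<Sum>x\<in>F. \<xi> x * ell2_inner X (T (delta x)) \<eta>)"
      unfolding cutoff_finite_eq_sum[OF that(2)] using d that
      by (subst bounded_ops_sum[OF T]) (auto intro: ell2_inner_sum_left)
    also have "\<dots> = (\<Sum>x\<in>F. \<xi> x * cnj (S \<eta> x))"
      using that by (intro sum.cong) (auto simp: S_def ell2_inner_cnj)
    finally show ?thesis .
  qed
  have bound: "L2_set (\<lambda>x. cmod (S \<eta> x)) F \<le> K * ell2_norm X \<eta>"
    if \<eta>: "\<eta> \<in> ell2 X" and F: "finite F" "F \<subseteq> X" for \<eta> F
  proof -
    let ?L = "L2_set (\<lambda>x. cmod (S \<eta> x)) F"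
    have cutE: "cutoff F (S \<eta>) \<in> ell2 X"
      unfolding cutoff_finite_eq_sum[OF F(1)] using F
      by (intro ell2_sum_closed ell2_scale_closed) auto
    have norm_cutoff: "ell2_norm X (cutoff F (S \<eta>)) = ?L"
    proof -
      have "(ell2_norm X (cutoff F (S \<eta>)))\<^sup>2 = (\<Sum>x\<in>F. (cmod (S \<eta> x))\<^sup>2)"
        unfolding ell2_norm_cutoff_sq using F by (simp add: Int_absorb1)
      then show ?thesis
        by (metis L2_set_def abs_of_nonneg ell2_norm_nonneg real_sqrt_abs)
    qed
    have "complex_of_real (?L\<^sup>2) = (\<Sum>x\<in>F. S \<eta> x * cnj (S \<eta> x))"
      by (simp add: L2_set_def sum_nonneg flip: complex_norm_square)
    also have "\<dots> = ell2_inner X (T (cutoff F (S \<eta>))) \<eta>"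
      using fin[OF \<eta> F] by simp
    finally have "?L\<^sup>2 = cmod (ell2_inner X (T (cutoff F (S \<eta>))) \<eta>)"
      by (metis abs_of_nonneg norm_of_real zero_le_power2)
    also have "\<dots> \<le> ell2_norm X (T (cutoff F (S \<eta>))) * ell2_norm X \<eta>"
      by (intro ell2_inner_bound bounded_ops_ell2[OF T] \<eta>)
    also have "\<dots> \<le> (K * ?L) * ell2_norm X \<eta>"
      using K(2)[OF cutE] by (intro mult_right_mono) (auto simp: norm_cutoff)
    finally have "?L * ?L \<le> ?L * (K * ell2_norm X \<eta>)"
      by (simp add: power2_eq_square mult_ac)
    then show ?thesis
      using K(1) L2_set_nonneg[of "\<lambda>x. cmod (S \<eta> x)" F]
      by (cases "?L = 0") (auto simp: mult_le_cancel_left)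
  qed
  have S_ell2: "S \<eta> \<in> ell2 X" and S_bound: "ell2_norm X (S \<eta>) \<le> K * ell2_norm X \<eta>"
    if "\<eta> \<in> ell2 X" for \<eta>
    using ell2_boundedI[of X "S \<eta>" "K * ell2_norm X \<eta>"] bound[OF that] by (auto simp: S_def)
  have "S \<in> bounded_ops X"
  proof (rule bounded_opsI[where K = K])
    fix \<xi> \<eta> assume "\<xi> \<in> ell2 X" "\<eta> \<in> ell2 X"
    then show "S (\<lambda>x. \<xi> x + \<eta> x) = (\<lambda>x. S \<xi> x + S \<eta> x)"
      by (auto simp: S_def ell2_add_closed ell2_inner_add_left bounded_ops_ell2[OF T])
  qed (auto simp: S_ell2 S_bound, auto simp: S_def ell2_scale_closed ell2_inner_scale_left)
  moreover have "ell2_inner X (T \<xi>) \<eta> = ell2_inner X \<xi> (S \<eta>)"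
    if \<xi>: "\<xi> \<in> ell2 X" and \<eta>: "\<eta> \<in> ell2 X" for \<xi> \<eta>
  proof -
    \<comment> \<open>Both inner products are continuous in \<open>\<xi>\<close> and agree on its finite truncations.\<close>
  have small: "cmod (ell2_inner X (T \<xi>) \<eta> - ell2_inner X \<xi> (S \<eta>)) \<le> \<epsilon> * (2 * K * ell2_norm X \<eta>)"
      if \<epsilon>: "\<epsilon> > 0" for \<epsilon>
    proof -
      obtain F where F: "finite F" "F \<subseteq> X" and tail: "ell2_norm X (cutoff (- F) \<xi>) \<le> \<epsilon>"
        using ell2_truncation[OF \<xi> \<epsilon>] by blast
      have "ell2_inner X (cutoff F \<xi>) (S \<eta>) = (\<Sum>\<^sub>\<infinity>x\<in>F. \<xi> x * cnj (S \<eta> x))"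
        unfolding ell2_inner_def using F by (intro infsum_cong_neutral) (auto simp: cutoff_def)
      then have head: "ell2_inner X (T (cutoff F \<xi>)) \<eta> = ell2_inner X (cutoff F \<xi>) (S \<eta>)"
        using fin[OF \<eta> F] F by simp
      have 1: "ell2_inner X (T \<xi>) \<eta>
          = ell2_inner X (T (cutoff F \<xi>)) \<eta> + ell2_inner X (T (cutoff (- F) \<xi>)) \<eta>"
        by (subst cutoff_split[of \<xi> F])
          (simp only: bounded_ops_add[OF T] ell2_inner_add_left ell2_cutoff \<xi> \<eta> bounded_ops_ell2[OF T])
      have 2: "ell2_inner X \<xi> (S \<eta>)
          = ell2_inner X (cutoff F \<xi>) (S \<eta>) + ell2_inner X (cutoff (- F) \<xi>) (S \<eta>)"
        by (subst cutoff_split[of \<xi> F]) (simp only: ell2_inner_add_left ell2_cutoff \<xi> S_ell2 \<eta>)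
      have "cmod (ell2_inner X (T \<xi>) \<eta> - ell2_inner X \<xi> (S \<eta>))
          = cmod (ell2_inner X (T (cutoff (- F) \<xi>)) \<eta> - ell2_inner X (cutoff (- F) \<xi>) (S \<eta>))"
        by (simp add: 1 2 head)
      also have "\<dots> \<le> cmod (ell2_inner X (T (cutoff (- F) \<xi>)) \<eta>)
          + cmod (ell2_inner X (cutoff (- F) \<xi>) (S \<eta>))"
        by (rule norm_triangle_ineq4)
      also have "\<dots> \<le> ell2_norm X (T (cutoff (- F) \<xi>)) * ell2_norm X \<eta>
          + ell2_norm X (cutoff (- F) \<xi>) * ell2_norm X (S \<eta>)"
        by (intro add_mono ell2_inner_bound bounded_ops_ell2[OF T] ell2_cutoff \<xi> \<eta> S_ell2)
      also have "\<dots> \<le> (K * \<epsilon>) * ell2_norm X \<eta> + \<epsilon> * (K * ell2_norm X \<eta>)"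
      proof (intro add_mono mult_mono)
        show "ell2_norm X (T (cutoff (- F) \<xi>)) \<le> K * \<epsilon>"
          using K(2)[OF ell2_cutoff[OF \<xi>], of "- F"] mult_left_mono[OF tail K(1)] by linarith
      qed (use tail S_bound[OF \<eta>] K(1) \<epsilon> in auto)
      finally show ?thesis
        by (simp add: algebra_simps)
    qed
    have "cmod (ell2_inner X (T \<xi>) \<eta> - ell2_inner X \<xi> (S \<eta>)) \<le> 0"
    proof (rule field_le_epsilon)
      fix e :: real assume e: "e > 0"
      let ?C = "2 * K * ell2_norm X \<eta>"
      have C: "?C \<ge> 0" using K(1) by simp
      have "e / (?C + 1) * ?C \<le> e"
        using e C by (simp add: field_simps)
      then show "cmod (ell2_inner X (T \<xi>) \<eta> - ell2_inner X \<xi> (S \<eta>)) \<le> 0 + e"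
        using small[of "e / (?C + 1)"] e C by (smt (verit) divide_pos_pos)
    qed
    then show ?thesis by simp
  qed
  ultimately show ?thesis
    unfolding is_adj_def by blast
qed

lemma is_adj_adj: "T \<in> bounded_ops X \<Longrightarrow> is_adj X T (op_adj X T)"
  using adj_exists is_adj_op_adj by metis

lemma bounded_ops_adj: "T \<in> bounded_ops X \<Longrightarrow> op_adj X T \<in> bounded_ops X"
  using is_adj_adj by (auto simp: is_adj_def)

lemma inner_adj_right:
  "T \<in> bounded_ops X \<Longrightarrow> \<xi> \<in> ell2 X \<Longrightarrow> \<eta> \<in> ell2 X \<Longrightarrow>
    ell2_inner X \<xi> (op_adj X T \<eta>) = ell2_inner X (T \<xi>) \<eta>"
  using is_adj_adj[of T X] by (simp add: is_adj_def)

lemma inner_adj_left: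
  "T \<in> bounded_ops X \<Longrightarrow> \<xi> \<in> ell2 X \<Longrightarrow> \<eta> \<in> ell2 X \<Longrightarrow>
    ell2_inner X (op_adj X T \<xi>) \<eta> = ell2_inner X \<xi> (T \<eta>)"
  by (metis ell2_inner_cnj inner_adj_right)

lemma op_adj_adj: "T \<in> bounded_ops X \<Longrightarrow> op_adj X (op_adj X T) = T"
  by (rule is_adj_op_adj) (simp add: is_adj_def inner_adj_left)

lemma op_adj_comp:
  "S \<in> bounded_ops X \<Longrightarrow> T \<in> bounded_ops X \<Longrightarrow> op_adj X (S \<circ> T) = op_adj X T \<circ> op_adj X S"
  by (rule is_adj_op_adj)
    (simp add: is_adj_def bounded_ops_comp bounded_ops_adj inner_adj_right bounded_ops_ell2)

lemma coisometry_adj_norm: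
  assumes v: "v \<in> bounded_ops X" and "v \<circ> op_adj X v = op_id X" and \<xi>: "\<xi> \<in> ell2 X"
  shows "ell2_norm X (op_adj X v \<xi>) = ell2_norm X \<xi>"
proof -
  have e: "v (op_adj X v \<xi>) = \<xi>"
    using fun_cong[OF assms(2), of \<xi>] \<xi> by (simp add: op_id_def)
  have "complex_of_real ((ell2_norm X (op_adj X v \<xi>))\<^sup>2) = ell2_inner X \<xi> (v (op_adj X v \<xi>))"
    using inner_adj_left[OF v \<xi>, of "op_adj X v \<xi>"]
    by (simp add: ell2_inner_self bounded_ops_ell2[OF bounded_ops_adj[OF v]])
  also have "\<dots> = of_real ((ell2_norm X \<xi>)\<^sup>2)"
    by (simp add: e ell2_inner_self \<xi>)
  finally show ?thesis
    by (simp only: of_real_eq_iff power2_eq_iff_nonneg ell2_norm_nonneg)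
qed

lemma op_adj_entry:
  assumes "T \<in> bounded_ops X" "s \<in> X" "t \<in> X"
  shows "op_adj X T (delta t) s = cnj (T (delta s) t)"
  using inner_adj_right[OF assms(1), of "delta s" "delta t"] assms
  by (simp add: ell2_inner_delta_left ell2_inner_delta_right complex_eq_iff)

text \<open>The rows of the matrix of \<open>T\<close> are conjugate to the columns of the adjoint, hence
square-summable; therefore a bounded operator acts through its matrix.\<close>

lemma op_apply_row:
  assumes T: "T \<in> bounded_ops X" and \<xi>: "\<xi> \<in> ell2 X" and s: "s \<in> X"
  shows "T \<xi> s = (\<Sum>\<^sub>\<infinity>t\<in>X. T (delta t) s * \<xi> t)"
proof -
  have "T \<xi> s = ell2_inner X \<xi> (op_adj X T (delta s))"
    using assms by (simp add: inner_adj_right ell2_inner_delta_right)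
  also have "\<dots> = (\<Sum>\<^sub>\<infinity>t\<in>X. T (delta t) s * \<xi> t)"
    unfolding ell2_inner_def
    by (intro infsum_cong) (simp add: op_adj_entry[OF T] s)
  finally show ?thesis .
qed

lemma bounded_ops_eqI:
  assumes S: "S \<in> bounded_ops X" and T: "T \<in> bounded_ops X"
    and entries: "\<And>s t. s \<in> X \<Longrightarrow> t \<in> X \<Longrightarrow> S (delta t) s = T (delta t) s"
  shows "S = T"
proof (rule ext, rule ext)
  fix \<xi> s
  show "S \<xi> s = T \<xi> s"
  proof (cases "\<xi> \<in> ell2 X \<and> s \<in> X")
    case True
    then show ?thesis
      using entries op_apply_row[OF S, of \<xi> s] op_apply_row[OF T, of \<xi> s]
      by (simp cong: infsum_cong)
  next
    case False
    then show ?thesis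
      using bounded_ops_off[OF S] bounded_ops_off[OF T] ell2_zero_off bounded_ops_ell2[OF S]
        bounded_ops_ell2[OF T] by metis
  qed
qed

section \<open>The bicommutant\<close>

lemma commutant_antimono: "N \<subseteq> N' \<Longrightarrow> commutant X N' \<subseteq> commutant X N"
  by (auto simp: commutant_def)

lemma subset_bicommutant: "N \<subseteq> bounded_ops X \<Longrightarrow> N \<subseteq> commutant X (commutant X N)"
  by (auto simp: commutant_def)

lemma commutant_bounded: "commutant X N \<subseteq> bounded_ops X"
  by (auto simp: commutant_def)

lemma commutant_adj:
  assumes "N \<subseteq> bounded_ops X" "\<And>S. S \<in> N \<Longrightarrow> op_adj X S \<in> N" "T \<in> commutant X N"
  shows "op_adj X T \<in> commutant X N"
proof -
  have T: "T \<in> bounded_ops X"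
    using assms(3) by (simp add: commutant_def)
  have "op_adj X T \<circ> S = S \<circ> op_adj X T" if "S \<in> N" for S
  proof -
    have S: "S \<in> bounded_ops X" "op_adj X S \<in> bounded_ops X"
      using assms that by (auto simp: bounded_ops_adj)
    have "T \<circ> op_adj X S = op_adj X S \<circ> T"
      using assms that by (simp add: commutant_def)
    then have "op_adj X (T \<circ> op_adj X S) = op_adj X (op_adj X S \<circ> T)"
      by simp
    then show ?thesis
      using S T by (simp add: op_adj_comp op_adj_adj)
  qed
  then show ?thesis
    using bounded_ops_adj[OF T] by (simp add: commutant_def)
qed

lemma commutant_comp:
  "S \<in> commutant X N \<Longrightarrow> T \<in> commutant X N \<Longrightarrow> S \<circ> T \<in> commutant X N"
  unfolding commutant_def by (simp add: bounded_ops_comp comp_assoc) (simp flip: comp_assoc)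

lemma bicommutant_vna:
  assumes "N \<subseteq> bounded_ops X" "\<And>S. S \<in> N \<Longrightarrow> op_adj X S \<in> N"
  shows "von_neumann_algebra X (commutant X (commutant X N))"
  unfolding von_neumann_algebra_def
proof (intro conjI ballI)
  show "op_adj X T \<in> commutant X (commutant X N)" if "T \<in> commutant X (commutant X N)" for T
    using that assms by (intro commutant_adj commutant_bounded) auto
  have "commutant X (commutant X (commutant X N)) = commutant X N"
    by (intro subset_antisym commutant_antimono subset_bicommutant assms commutant_bounded)
  then show "commutant X (commutant X (commutant X (commutant X N))) = commutant X (commutant X N)"
    by simp
qed (rule commutant_bounded)

text \<open>The bicommutant is itself a von Neumann algebra, because a third commutant is a first commutant,
and taking commutants twice preserves inclusions, so every von Neumann algebra containing \<open>N\<close>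
contains the bicommutant of \<open>N\<close>.\<close>

lemma vn_generated_eq_bicommutant:
  assumes "N \<subseteq> bounded_ops X" "\<And>S. S \<in> N \<Longrightarrow> op_adj X S \<in> N"
  shows "vn_generated X N = commutant X (commutant X N)"
proof
  show "vn_generated X N \<subseteq> commutant X (commutant X N)"
    unfolding vn_generated_def
    using bicommutant_vna[OF assms] subset_bicommutant[OF assms(1)] by blast
  have "commutant X (commutant X N) \<subseteq> N'" if "von_neumann_algebra X N'" "N \<subseteq> N'" for N'
    using commutant_antimono[OF commutant_antimono[OF that(2)], of X X] that(1)
    by (auto simp: von_neumann_algebra_def)
  then show "commutant X (commutant X N) \<subseteq> vn_generated X N"
    unfolding vn_generated_def by blast
qed

section \<open>Pinching along a partition\<close>

text \<open>The block-diagonal part of an operator, for the partition of \<open>X\<close> into the fibres of \<open>p\<close>.\<close>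

definition pinching :: "'a set \<Rightarrow> ('a \<Rightarrow> 'b) \<Rightarrow> 'a operator \<Rightarrow> 'a operator" where
  "pinching X p T = (\<lambda>\<eta> k. if \<eta> \<in> ell2 X \<and> k \<in> X then T (cutoff {s. p s = p k} \<eta>) k else 0)"

lemma sum_ell2_norm_cutoff_le:
  assumes \<eta>: "\<eta> \<in> ell2 X" and A: "finite A"
  shows "(\<Sum>c\<in>A. (ell2_norm X (cutoff {s. p s = c} \<eta>))\<^sup>2) \<le> (ell2_norm X \<eta>)\<^sup>2"
proof -
  have summ: "(\<lambda>x. (cmod (\<eta> x))\<^sup>2) summable_on Y" if "Y \<subseteq> X" for Y
    using \<eta> that by (auto simp: ell2_def intro: summable_on_subset_banach)
  have "(\<Sum>c\<in>A. (ell2_norm X (cutoff {s. p s = c} \<eta>))\<^sup>2)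
      = (\<Sum>\<^sub>\<infinity>x\<in>(\<Union>c\<in>A. X \<inter> {s. p s = c}). (cmod (\<eta> x))\<^sup>2)"
    unfolding ell2_norm_cutoff_sq using A by (intro sum_infsum summ) auto
  also have "\<dots> \<le> (\<Sum>\<^sub>\<infinity>x\<in>X. (cmod (\<eta> x))\<^sup>2)"
    by (intro infsum_mono2 summ) auto
  finally show ?thesis
    by (simp add: ell2_norm_sq)
qed

text \<open>Vectors supported in different blocks are orthogonal, so squared norms add up over the blocks
and a bound for \<open>T\<close> is also a bound for its pinching.\<close>

lemma pinching_bounded:
  assumes T: "T \<in> bounded_ops X"
  shows "pinching X p T \<in> bounded_ops X"
proof -
  obtain K where K: "K \<ge> 0" "\<And>\<xi>. \<xi> \<in> ell2 X \<Longrightarrow> ell2_norm X (T \<xi>) \<le> K * ell2_norm X \<xi>"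
    using bounded_ops_bound[OF T] by blast
  have bound: "L2_set (\<lambda>k. cmod (pinching X p T \<eta> k)) F \<le> K * ell2_norm X \<eta>"
    if \<eta>: "\<eta> \<in> ell2 X" and F: "finite F" "F \<subseteq> X" for \<eta> F
  proof -
    define \<eta>c where "\<eta>c c = cutoff {s. p s = c} \<eta>" for c
    have \<eta>c: "\<eta>c c \<in> ell2 X" for c
      by (simp add: \<eta>c_def ell2_cutoff \<eta>)
    have "(\<Sum>k\<in>F. (cmod (pinching X p T \<eta> k))\<^sup>2) = (\<Sum>k\<in>F. (cmod (T (\<eta>c (p k)) k))\<^sup>2)"
      using F \<eta> by (intro sum.cong) (auto simp: pinching_def \<eta>c_def)
    also have "\<dots> = (\<Sum>c\<in>p ` F. \<Sum>k\<in>{k. k \<in> F \<and> p k = c}. (cmod (T (\<eta>c (p k)) k))\<^sup>2)"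
      by (rule sum.image_gen[OF F(1)])
    also have "\<dots> \<le> (\<Sum>c\<in>p ` F. (K * ell2_norm X (\<eta>c c))\<^sup>2)"
    proof (rule sum_mono)
      fix c
      have "(\<Sum>k\<in>{k. k \<in> F \<and> p k = c}. (cmod (T (\<eta>c (p k)) k))\<^sup>2)
          = (L2_set (\<lambda>k. cmod (T (\<eta>c c) k)) {k. k \<in> F \<and> p k = c})\<^sup>2"
        by (simp add: L2_set_def sum_nonneg)
      also have "\<dots> \<le> (ell2_norm X (T (\<eta>c c)))\<^sup>2"
        using F by (intro power_mono L2_set_le_ell2_norm bounded_ops_ell2[OF T]) auto
      also have "\<dots> \<le> (K * ell2_norm X (\<eta>c c))\<^sup>2"
        by (intro power_mono K \<eta>c) auto
      finally show "(\<Sum>k\<in>{k. k \<in> F \<and> p k = c}. (cmod (T (\<eta>c (p k)) k))\<^sup>2)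
          \<le> (K * ell2_norm X (\<eta>c c))\<^sup>2" .
    qed
    also have "\<dots> = K\<^sup>2 * (\<Sum>c\<in>p ` F. (ell2_norm X (\<eta>c c))\<^sup>2)"
      by (simp add: power_mult_distrib sum_distrib_left)
    also have "\<dots> \<le> K\<^sup>2 * (ell2_norm X \<eta>)\<^sup>2"
      unfolding \<eta>c_def using F by (intro mult_left_mono sum_ell2_norm_cutoff_le \<eta>) auto
    also have "\<dots> = (K * ell2_norm X \<eta>)\<^sup>2"
      by (simp add: power_mult_distrib)
    finally show ?thesis
      unfolding L2_set_def using K(1) by (intro real_le_lsqrt) auto
  qed
  have pc: "pinching X p T \<eta> \<in> ell2 X" "ell2_norm X (pinching X p T \<eta>) \<le> K * ell2_norm X \<eta>"
    if "\<eta> \<in> ell2 X" for \<eta>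
    using ell2_boundedI[of X "pinching X p T \<eta>" "K * ell2_norm X \<eta>"] bound[OF that]
    by (auto simp: pinching_def)
  show ?thesis
  proof (rule bounded_opsI[where K = K])
    fix \<xi> \<eta> assume *: "\<xi> \<in> ell2 X" "\<eta> \<in> ell2 X"
    have "cutoff S (\<lambda>x. \<xi> x + \<eta> x) = (\<lambda>x. cutoff S \<xi> x + cutoff S \<eta> x)" for S
      by (auto simp: cutoff_def)
    with * show "pinching X p T (\<lambda>x. \<xi> x + \<eta> x) = (\<lambda>x. pinching X p T \<xi> x + pinching X p T \<eta> x)"
      by (auto simp: pinching_def ell2_add_closed bounded_ops_add[OF T] ell2_cutoff)
  next
    fix c \<xi> assume *: "\<xi> \<in> ell2 X"
    have "cutoff S (\<lambda>x. c * \<xi> x) = (\<lambda>x. c * cutoff S \<xi> x)" for S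
      by (auto simp: cutoff_def)
    with * show "pinching X p T (\<lambda>x. c * \<xi> x) = (\<lambda>x. c * pinching X p T \<xi> x)"
      by (auto simp: pinching_def ell2_scale_closed bounded_ops_scale[OF T] ell2_cutoff)
  qed (use pc in auto, auto simp: pinching_def)
qed

lemma pinching_delta:
  assumes T: "T \<in> bounded_ops X" and "s \<in> X" "t \<in> X"
  shows "pinching X p T (delta t) s = (if p t = p s then T (delta t) s else 0)"
proof -
  have "cutoff {r. p r = p s} (delta t) = (if p t = p s then delta t else (\<lambda>x. 0))"
    by (auto simp: cutoff_def delta_def)
  then show ?thesis
    using assms by (simp add: pinching_def bounded_ops_zero[OF T])
qed

text \<open>The inner product splits into the sum over the blocks of \<open>\<langle>T \<eta>\<^sub>c, \<eta>\<^sub>c\<rangle>\<close>, where \<open>\<eta>\<^sub>c\<close> is the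
part of \<open>\<eta>\<close> in the block \<open>c\<close>.\<close>

lemma pinching_positive:
  assumes T: "T \<in> bounded_ops X" and pos: "op_positive X T"
  shows "op_positive X (pinching X p T)"
  unfolding op_positive_def
proof
  fix \<eta> assume \<eta>: "\<eta> \<in> ell2 X"
  define f where "f k = pinching X p T \<eta> k * cnj (\<eta> k)" for k
  let ?S = "Sigma (p ` X) (\<lambda>c. {k \<in> X. p k = c})"
  \<comment> \<open>\<open>X\<close> as the disjoint union of its blocks, to sum over each block first\<close>
  have bij: "bij_betw snd ?S X"
    by (rule bij_betw_byWitness[where f' = "\<lambda>k. (p k, k)"]) auto
  have f: "f summable_on X"
    unfolding f_def by (intro ell2_inner_summable_on bounded_ops_ell2 pinching_bounded T \<eta>)
  have sig: "(\<lambda>(c, k). f k) summable_on ?S"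
    using f summable_on_reindex_bij_betw[OF bij, of f] by (simp add: case_prod_unfold)
  have block: "(\<Sum>\<^sub>\<infinity>k\<in>{k \<in> X. p k = c}. f k)
      = ell2_inner X (T (cutoff {s. p s = c} \<eta>)) (cutoff {s. p s = c} \<eta>)" for c
    unfolding ell2_inner_def f_def
    by (rule infsum_cong_neutral) (auto simp: pinching_def cutoff_def \<eta>)
  have nonneg: "0 \<le> (\<Sum>\<^sub>\<infinity>k\<in>{k \<in> X. p k = c}. f k)" for c
    using pos ell2_cutoff[OF \<eta>, of "{s. p s = c}"]
    by (simp add: block op_positive_def complex_nonneg_Reals_iff less_eq_complex_def)
  have "ell2_inner X (pinching X p T \<eta>) \<eta> = (\<Sum>\<^sub>\<infinity>k\<in>X. f k)"
    by (simp add: ell2_inner_def f_def)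
  also have "\<dots> = (\<Sum>\<^sub>\<infinity>(c, k)\<in>?S. f k)"
    using infsum_reindex_bij_betw[OF bij, of f] by (simp add: case_prod_unfold)
  also have "\<dots> = (\<Sum>\<^sub>\<infinity>c\<in>p ` X. \<Sum>\<^sub>\<infinity>k\<in>{k \<in> X. p k = c}. f k)"
    using infsum_Sigma'_banach[OF sig] by simp
  also have "0 \<le> \<dots>"
    by (intro infsum_nonneg_complex summable_on_Sigma_banach[OF sig] nonneg)
  finally show "ell2_inner X (pinching X p T \<eta>) \<eta> \<in> \<real>\<^sub>\<ge>\<^sub>0"
    by (simp add: complex_nonneg_Reals_iff less_eq_complex_def)
qed

text \<open>Operators that map each block to itself commute with the projections onto the blocks.\<close>

lemma pinching_bimodule:
  assumes a: "a \<in> bounded_ops X" and x: "x \<in> bounded_ops X" and b: "b \<in> bounded_ops X"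
    and a_block: "\<And>\<eta> c. \<eta> \<in> ell2 X \<Longrightarrow> a (cutoff {s. p s = c} \<eta>) = cutoff {s. p s = c} (a \<eta>)"
    and b_block: "\<And>\<eta> c. \<eta> \<in> ell2 X \<Longrightarrow> b (cutoff {s. p s = c} \<eta>) = cutoff {s. p s = c} (b \<eta>)"
  shows "pinching X p (a \<circ> x \<circ> b) = a \<circ> pinching X p x \<circ> b"
proof (rule ext, rule ext)
  fix \<eta> k
  note ax = bounded_ops_comp[OF a x]
  have B: "pinching X p (a \<circ> x \<circ> b) \<in> bounded_ops X" "a \<circ> pinching X p x \<circ> b \<in> bounded_ops X"
    using a x b by (auto intro!: pinching_bounded bounded_ops_comp simp del: comp_apply)
  show "pinching X p (a \<circ> x \<circ> b) \<eta> k = (a \<circ> pinching X p x \<circ> b) \<eta> k"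
  proof (cases "\<eta> \<in> ell2 X \<and> k \<in> X")
    case True
    let ?P = "cutoff {s. p s = p k}"
    have b\<eta>: "b \<eta> \<in> ell2 X"
      by (rule bounded_ops_ell2[OF b])
    have same: "?P (x (?P (b \<eta>))) = ?P (pinching X p x (b \<eta>))"
      using b\<eta> ell2_zero_off[OF bounded_ops_ell2[OF x]]
      by (auto simp: cutoff_def fun_eq_iff pinching_def)
    have "pinching X p (a \<circ> x \<circ> b) \<eta> k = ?P (a (x (?P (b \<eta>)))) k"
      using True by (simp add: pinching_def b_block) (simp add: cutoff_def)
    also have "\<dots> = ?P (a (pinching X p x (b \<eta>))) k"
      by (simp add: same bounded_ops_ell2[OF x] bounded_ops_ell2[OF pinching_bounded[OF x]]
          flip: a_block)
    also have "\<dots> = a (pinching X p x (b \<eta>)) k"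
      by (simp add: cutoff_def)
    finally show ?thesis by simp
  next
    case False
    then show ?thesis
      using bounded_ops_off[OF B(1)] bounded_ops_off[OF B(2)]
        ell2_zero_off[OF bounded_ops_ell2[OF B(1)]] ell2_zero_off[OF bounded_ops_ell2[OF B(2)]]
      by metis
  qed
qed

section \<open>Permutation and coordinate operators\<close>

definition translation :: "'a set \<Rightarrow> ('a \<Rightarrow> 'a) \<Rightarrow> 'a operator" where
  "translation X f = (\<lambda>\<xi>. if \<xi> \<in> ell2 X then (\<lambda>h. if h \<in> X then \<xi> (f h) else 0) else (\<lambda>h. 0))"

lemma translation_ell2:
  assumes f: "bij_betw f X X" and \<xi>: "\<xi> \<in> ell2 X"
  shows "translation X f \<xi> \<in> ell2 X" "ell2_norm X (translation X f \<xi>) = ell2_norm X \<xi>"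
proof -
  have "(\<lambda>h. (cmod (translation X f \<xi> h))\<^sup>2) summable_on X
      \<longleftrightarrow> (\<lambda>h. (cmod (\<xi> (f h)))\<^sup>2) summable_on X"
    using \<xi> by (intro summable_on_cong) (simp add: translation_def)
  then have "(\<lambda>h. (cmod (translation X f \<xi> h))\<^sup>2) summable_on X"
    using \<xi> summable_on_reindex_bij_betw[OF f, of "\<lambda>h. (cmod (\<xi> h))\<^sup>2"] by (simp add: ell2_def)
  then show "translation X f \<xi> \<in> ell2 X"
    unfolding ell2_def using \<xi> by (auto simp: translation_def)
  have "(\<Sum>\<^sub>\<infinity>h\<in>X. (cmod (translation X f \<xi> h))\<^sup>2) = (\<Sum>\<^sub>\<infinity>h\<in>X. (cmod (\<xi> (f h)))\<^sup>2)"
    using \<xi> by (intro infsum_cong) (simp add: translation_def)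
  also have "\<dots> = (\<Sum>\<^sub>\<infinity>h\<in>X. (cmod (\<xi> h))\<^sup>2)"
    using infsum_reindex_bij_betw[OF f, of "\<lambda>h. (cmod (\<xi> h))\<^sup>2"] .
  finally show "ell2_norm X (translation X f \<xi>) = ell2_norm X \<xi>"
    by (simp add: ell2_norm_def)
qed

lemma translation_bounded:
  assumes f: "bij_betw f X X" shows "translation X f \<in> bounded_ops X"
proof (rule bounded_opsI[where K = 1])
  fix \<xi> \<eta> assume "\<xi> \<in> ell2 X" "\<eta> \<in> ell2 X"
  then show "translation X f (\<lambda>x. \<xi> x + \<eta> x) = (\<lambda>x. translation X f \<xi> x + translation X f \<eta> x)"
    by (auto simp: translation_def ell2_add_closed)
next
  fix c \<xi> assume "\<xi> \<in> ell2 X"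
  then show "translation X f (\<lambda>x. c * \<xi> x) = (\<lambda>x. c * translation X f \<xi> x)"
    by (auto simp: translation_def ell2_scale_closed)
qed (simp_all add: translation_ell2[OF f], simp add: translation_def)

lemma translation_delta:
  assumes "t \<in> X" "\<And>h. h \<in> X \<Longrightarrow> f h = t \<longleftrightarrow> h = u" "u \<in> X"
  shows "translation X f (delta t) = delta u"
  using assms ell2_delta[OF assms(1)] by (auto simp: translation_def) (auto simp: delta_def)

lemma cutoff_bounded: "(\<lambda>\<xi>. if \<xi> \<in> ell2 X then cutoff S \<xi> else (\<lambda>x. 0)) \<in> bounded_ops X"
  by (rule bounded_opsI[where K = 1])
    (auto simp: ell2_cutoff ell2_norm_cutoff_le ell2_add_closed ell2_scale_closed, auto simp: cutoff_def)

section \<open>Von Neumann algebras of subgroups\<close>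

context group
begin

lemma mult_inv_cancel [simp]:
  assumes "x \<in> carrier G" "y \<in> carrier G"
  shows "x \<otimes> (inv x \<otimes> y) = y" "inv x \<otimes> (x \<otimes> y) = y"
  using assms by (simp_all add: m_assoc[symmetric])

lemma left_mult_bij: "g \<in> carrier G \<Longrightarrow> bij_betw (\<lambda>h. g \<otimes> h) (carrier G) (carrier G)"
  by (rule bij_betw_byWitness[where f' = "\<lambda>h. inv g \<otimes> h"]) auto

lemma right_mult_bij: "g \<in> carrier G \<Longrightarrow> bij_betw (\<lambda>h. h \<otimes> g) (carrier G) (carrier G)"
  by (rule bij_betw_byWitness[where f' = "\<lambda>h. h \<otimes> inv g"]) (auto simp: m_assoc)

lemma left_regular_translation:
  "left_regular G g = translation (carrier G) (\<lambda>h. inv g \<otimes> h)"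
  by (simp add: left_regular_def translation_def)

lemma left_regular_bounded: "g \<in> carrier G \<Longrightarrow> left_regular G g \<in> bounded_ops (carrier G)"
  unfolding left_regular_translation by (intro translation_bounded left_mult_bij inv_closed)

lemma left_regular_apply:
  "g \<in> carrier G \<Longrightarrow> s \<in> carrier G \<Longrightarrow> \<xi> \<in> ell2 (carrier G) \<Longrightarrow>
    left_regular G g \<xi> s = \<xi> (inv g \<otimes> s)"
  by (simp add: left_regular_def)

lemma left_regular_delta:
  "g \<in> carrier G \<Longrightarrow> t \<in> carrier G \<Longrightarrow> left_regular G g (delta t) = delta (g \<otimes> t)"
  unfolding left_regular_translation
  by (rule translation_delta) auto

lemma left_regular_mult:
  assumes "g \<in> carrier G" "h \<in> carrier G"
  shows "left_regular G g \<circ> left_regular G h = left_regular G (g \<otimes> h)"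
  using assms
  by (intro bounded_ops_eqI[of _ "carrier G"] bounded_ops_comp left_regular_bounded)
    (simp_all add: left_regular_delta m_assoc)

lemma left_regular_one: "left_regular G \<one> = op_id (carrier G)"
  by (rule bounded_ops_eqI[of _ "carrier G"])
    (auto simp: left_regular_bounded left_regular_delta bounded_ops_id, simp add: op_id_def)

lemma left_regular_adj:
  assumes g: "g \<in> carrier G"
  shows "op_adj (carrier G) (left_regular G g) = left_regular G (inv g)"
proof (rule bounded_ops_eqI[of _ "carrier G"])
  fix s t assume "s \<in> carrier G" "t \<in> carrier G"
  with g show "op_adj (carrier G) (left_regular G g) (delta t) s = left_regular G (inv g) (delta t) s"
    by (simp add: op_adj_entry[OF left_regular_bounded] left_regular_delta) (auto simp: delta_def)
qed (use g in \<open>auto intro: bounded_ops_adj left_regular_bounded\<close>)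

lemma group_vna_eq_bicommutant:
  assumes "subgroup H G"
  shows "group_vna G H
    = commutant (carrier G) (commutant (carrier G) (left_regular G ` H))"
proof -
  have H: "h \<in> H \<Longrightarrow> h \<in> carrier G" for h
    using assms subgroup.mem_carrier by fast
  show ?thesis
    unfolding group_vna_def using subgroup.m_inv_closed[OF assms]
    by (intro vn_generated_eq_bicommutant) (auto simp: left_regular_bounded left_regular_adj H)
qed

lemma group_vna_bounded: "subgroup H G \<Longrightarrow> T \<in> group_vna G H \<Longrightarrow> T \<in> bounded_ops (carrier G)"
  by (simp add: group_vna_eq_bicommutant commutant_def)

lemma group_vna_vna:
  assumes "subgroup H G" shows "von_neumann_algebra (carrier G) (group_vna G H)"
proof -
  have H: "h \<in> H \<Longrightarrow> h \<in> carrier G" for h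
    using assms subgroup.mem_carrier by fast
  show ?thesis
    unfolding group_vna_eq_bicommutant[OF assms] using subgroup.m_inv_closed[OF assms]
    by (intro bicommutant_vna) (auto simp: left_regular_bounded left_regular_adj H)
qed

lemma left_regular_in_group_vna:
  assumes "subgroup H G" "h \<in> H" shows "left_regular G h \<in> group_vna G H"
proof -
  have "left_regular G ` H \<subseteq> bounded_ops (carrier G)"
    using assms(1) by (auto simp: left_regular_bounded subgroup.mem_carrier)
  then show ?thesis
    using subset_bicommutant[of "left_regular G ` H" "carrier G"] assms(2)
    unfolding group_vna_eq_bicommutant[OF assms(1)] by blast
qed

lemma group_vna_comp:
  "subgroup H G \<Longrightarrow> S \<in> group_vna G H \<Longrightarrow> T \<in> group_vna G H \<Longrightarrow> S \<circ> T \<in> group_vna G H"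
  by (simp add: group_vna_eq_bicommutant commutant_comp)

lemma group_vna_adj:
  "subgroup H G \<Longrightarrow> T \<in> group_vna G H \<Longrightarrow> op_adj (carrier G) T \<in> group_vna G H"
  using group_vna_vna[of H] by (simp add: von_neumann_algebra_def)

lemma group_vna_mono:
  assumes "subgroup H G" "subgroup K G" "H \<subseteq> K"
  shows "group_vna G H \<subseteq> group_vna G K"
  unfolding group_vna_eq_bicommutant[OF assms(1)] group_vna_eq_bicommutant[OF assms(2)]
  by (intro commutant_antimono image_mono assms)

text \<open>Commuting generators lie in their own commutant, and this inclusion passes to the
bicommutant.\<close>

lemma group_vna_commute:
  assumes H: "subgroup H G" and comm: "\<And>g h. g \<in> H \<Longrightarrow> h \<in> H \<Longrightarrow> g \<otimes> h = h \<otimes> g"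
    and "a \<in> group_vna G H" "b \<in> group_vna G H"
  shows "a \<circ> b = b \<circ> a"
proof -
  have "left_regular G ` H \<subseteq> commutant (carrier G) (left_regular G ` H)"
    unfolding commutant_def
    by (auto simp: left_regular_bounded left_regular_mult subgroup.mem_carrier[OF H] simp del: comp_apply)
      (metis comm)
  then have "group_vna G H \<subseteq> commutant (carrier G) (left_regular G ` H)"
    unfolding group_vna_eq_bicommutant[OF H] by (rule commutant_antimono)
  then have "b \<in> commutant (carrier G) (left_regular G ` H)"
    using assms(4) by blast
  then show ?thesis
    using assms(3) unfolding group_vna_eq_bicommutant[OF H] commutant_def[of _ "commutant _ _"]
    by blast
qed

text \<open>Right translations and the projections onto right cosets \<open>H t\<close> commute with \<open>left_regular G h\<close>
for \<open>h \<in> H\<close>; that elements of the algebra commute with them gives the two conditions on the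
matrix. Conversely let \<open>S\<close> commute with all these \<open>left_regular G h\<close>, which says
\<open>S(hs,ht) = S(s,t)\<close>. The substitution \<open>u \<mapsto> t u\<inverse> s\<close> then turns the series
\<open>\<Sum>u. T(s,u) S(u,t)\<close> for \<open>T \<circ> S\<close> term by term into \<open>\<Sum>u. S(s,u) T(u,t)\<close>, the series for \<open>S \<circ> T\<close>.\<close>

lemma group_vna_iff:
  assumes H: "subgroup H G"
  shows "T \<in> group_vna G H \<longleftrightarrow> T \<in> bounded_ops (carrier G) \<and>
    (\<forall>s\<in>carrier G. \<forall>t\<in>carrier G. \<forall>g\<in>carrier G. T (delta (t \<otimes> g)) (s \<otimes> g) = T (delta t) s) \<and>
    (\<forall>s\<in>carrier G. \<forall>t\<in>carrier G. s \<otimes> inv t \<notin> H \<longrightarrow> T (delta t) s = 0)"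
    (is "_ \<longleftrightarrow> ?B \<and> ?inv \<and> ?supp")
proof
  note Hc = subgroup.mem_carrier[OF H]
  assume T: "T \<in> group_vna G H"
  then have B: ?B
    by (rule group_vna_bounded[OF H])
  have commutes: "T \<circ> S = S \<circ> T"
    if "S \<in> bounded_ops (carrier G)" "\<And>h. h \<in> H \<Longrightarrow> S \<circ> left_regular G h = left_regular G h \<circ> S" for S
  proof -
    have "S \<in> commutant (carrier G) (left_regular G ` H)"
      unfolding commutant_def using that by blast
    then show ?thesis
      using T unfolding group_vna_eq_bicommutant[OF H] commutant_def[of _ "commutant _ _"] by blast
  qed
  have ?inv
  proof (intro ballI)
    fix s t g assume c: "s \<in> carrier G" "t \<in> carrier G" "g \<in> carrier G"
    define R where "R = translation (carrier G) (\<lambda>h. h \<otimes> g)"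
    have R: "R \<in> bounded_ops (carrier G)"
      unfolding R_def using c by (intro translation_bounded right_mult_bij)
    have R_delta: "R (delta u) = delta (u \<otimes> inv g)" if "u \<in> carrier G" for u
      unfolding R_def using that c by (intro translation_delta) (auto simp: m_assoc)
    have "T \<circ> R = R \<circ> T"
    proof (rule commutes[OF R], rule bounded_ops_eqI[of _ "carrier G"])
      fix h s t assume "h \<in> H" "s \<in> carrier G" "t \<in> carrier G"
      then show "(R \<circ> left_regular G h) (delta t) s = (left_regular G h \<circ> R) (delta t) s"
        using c by (simp add: R_delta left_regular_delta Hc m_assoc)
    qed (auto intro!: bounded_ops_comp R left_regular_bounded Hc)
    then have "T (R (delta (t \<otimes> g))) s = R (T (delta (t \<otimes> g))) s"
      by (simp add: fun_eq_iff)
    then show "T (delta (t \<otimes> g)) (s \<otimes> g) = T (delta t) s"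
      using c by (simp add: R_delta m_assoc) (simp add: R_def translation_def bounded_ops_ell2[OF B])
  qed
  moreover have ?supp
  proof (intro ballI impI)
    fix s t assume c: "s \<in> carrier G" "t \<in> carrier G" "s \<otimes> inv t \<notin> H"
    define P where
      "P = (\<lambda>\<xi>. if \<xi> \<in> ell2 (carrier G) then cutoff (H #> t) \<xi> else (\<lambda>x. 0))"
    have P: "P \<in> bounded_ops (carrier G)"
      unfolding P_def by (rule cutoff_bounded)
    have P_delta: "P (delta u) = (if u \<in> H #> t then delta u else (\<lambda>x. 0))" if "u \<in> carrier G" for u
      using that by (simp add: P_def) (auto simp: cutoff_def delta_def)
    have coset: "u \<in> H #> t \<longleftrightarrow> u \<otimes> inv t \<in> H" if "u \<in> carrier G" for u
      using subgroup.rcos_module[OF H is_group c(2) that] .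
    have coset_mult: "h \<otimes> u \<in> H #> t \<longleftrightarrow> u \<in> H #> t" if "h \<in> H" "u \<in> carrier G" for h u
      using that c subgroup.m_closed[OF H, of h "u \<otimes> inv t"]
        subgroup.m_closed[OF H subgroup.m_inv_closed[OF H, of h], of "h \<otimes> (u \<otimes> inv t)"]
      by (auto simp: coset Hc m_assoc)
    have "T \<circ> P = P \<circ> T"
    proof (rule commutes[OF P], rule bounded_ops_eqI[of _ "carrier G"])
      fix h s t' assume "h \<in> H" "s \<in> carrier G" "t' \<in> carrier G"
      then show "(P \<circ> left_regular G h) (delta t') s = (left_regular G h \<circ> P) (delta t') s"
        using c by (simp add: P_delta left_regular_delta Hc coset_mult
            bounded_ops_zero[OF left_regular_bounded])
    qed (auto intro!: bounded_ops_comp P left_regular_bounded Hc)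
    then have "T (P (delta t)) s = P (T (delta t)) s"
      by (simp add: fun_eq_iff)
    then show "T (delta t) s = 0"
      using c coset[of s] coset[of t] subgroup.one_closed[OF H]
      by (simp add: P_delta) (simp add: P_def cutoff_def bounded_ops_ell2[OF B])
  qed
  ultimately show "?B \<and> ?inv \<and> ?supp"
    using B by simp
next
  note Hc = subgroup.mem_carrier[OF H]
  assume "?B \<and> ?inv \<and> ?supp"
  then have B: ?B and inva: ?inv and supp: ?supp
    by auto
  have "T \<circ> S = S \<circ> T" if S: "S \<in> commutant (carrier G) (left_regular G ` H)" for S
  proof -
    have SB: "S \<in> bounded_ops (carrier G)"
      using S by (simp add: commutant_def)
    have S_inv: "S (delta (h \<otimes> t)) (h \<otimes> s) = S (delta t) s"
      if "h \<in> H" "s \<in> carrier G" "t \<in> carrier G" for h s t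
    proof -
      have "S (left_regular G h (delta t)) (h \<otimes> s) = left_regular G h (S (delta t)) (h \<otimes> s)"
        using S that by (simp add: commutant_def fun_eq_iff)
      then show ?thesis
        using that by (simp add: left_regular_delta left_regular_apply Hc bounded_ops_ell2[OF SB])
    qed
    show ?thesis
    proof (rule bounded_ops_eqI[of _ "carrier G"])
      fix s t assume c: "s \<in> carrier G" "t \<in> carrier G"
      have bij: "bij_betw (\<lambda>u. t \<otimes> inv u \<otimes> s) (carrier G) (carrier G)"
        by (rule bij_betw_byWitness[where f' = "\<lambda>u. s \<otimes> inv u \<otimes> t"]) (use c in \<open>auto simp: inv_mult_group m_assoc\<close>)
      have entry: "T (delta (t \<otimes> inv u \<otimes> s)) s * S (delta t) (t \<otimes> inv u \<otimes> s)
          = S (delta u) s * T (delta t) u" if u: "u \<in> carrier G" for u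
      proof -
        have T_entry: "T (delta (t \<otimes> inv u \<otimes> s)) s = T (delta t) u"
          using inva[rule_format, of u t "inv u \<otimes> s"] u c by (simp add: m_assoc)
        show ?thesis
        proof (cases "u \<otimes> inv t \<in> H")
          case True
          then have "t \<otimes> inv u \<in> H"
            using subgroup.m_inv_closed[OF H True] u c by (simp add: inv_mult_group)
          from S_inv[OF this, of s u] show ?thesis
            using u c by (simp add: T_entry) (simp add: m_assoc)
        next
          case False
          then show ?thesis
            using supp u c by (simp add: T_entry)
        qed
      qed
      have "(T \<circ> S) (delta t) s = (\<Sum>\<^sub>\<infinity>u\<in>carrier G. T (delta u) s * S (delta t) u)"
        using c by (simp add: op_apply_row[OF B bounded_ops_ell2[OF SB]])
      also have "\<dots> = (\<Sum>\<^sub>\<infinity>u\<in>carrier G.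
          T (delta (t \<otimes> inv u \<otimes> s)) s * S (delta t) (t \<otimes> inv u \<otimes> s))"
        by (rule infsum_reindex_bij_betw[OF bij, symmetric])
      also have "\<dots> = (\<Sum>\<^sub>\<infinity>u\<in>carrier G. S (delta u) s * T (delta t) u)"
        by (rule infsum_cong) (rule entry)
      also have "\<dots> = (S \<circ> T) (delta t) s"
        using c by (simp add: op_apply_row[OF SB bounded_ops_ell2[OF B]])
      finally show "(T \<circ> S) (delta t) s = (S \<circ> T) (delta t) s" .
    qed (intro bounded_ops_comp B SB)+
  qed
  then show "T \<in> group_vna G H"
    using B unfolding group_vna_eq_bicommutant[OF H] commutant_def[of _ "commutant _ _"] by blast
qed

lemma group_vna_entry_eq_one:
  assumes "subgroup H G" "T \<in> group_vna G H" "s \<in> carrier G" "t \<in> carrier G"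
  shows "T (delta t) s = T (delta \<one>) (s \<otimes> inv t)"
proof -
  have "T (delta (\<one> \<otimes> t)) (s \<otimes> inv t \<otimes> t) = T (delta \<one>) (s \<otimes> inv t)"
    using assms unfolding group_vna_iff[OF assms(1)] by blast
  then show ?thesis
    using assms by (simp add: m_assoc)
qed

lemma group_vna_entry_zero:
  assumes "subgroup H G" "T \<in> group_vna G H" "s \<in> carrier G" "t \<in> carrier G" "s \<otimes> inv t \<notin> H"
  shows "T (delta t) s = 0"
  using assms unfolding group_vna_iff[OF assms(1)] by blast

lemma group_vnaI:
  assumes "subgroup H G" "T \<in> bounded_ops (carrier G)"
    and "\<And>s t g. s \<in> carrier G \<Longrightarrow> t \<in> carrier G \<Longrightarrow> g \<in> carrier G \<Longrightarrow>
      T (delta (t \<otimes> g)) (s \<otimes> g) = T (delta t) s"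
    and "\<And>s t. s \<in> carrier G \<Longrightarrow> t \<in> carrier G \<Longrightarrow> s \<otimes> inv t \<notin> H \<Longrightarrow> T (delta t) s = 0"
  shows "T \<in> group_vna G H"
  using assms unfolding group_vna_iff[OF assms(1)] by blast

lemma group_vna_entry_shift:
  assumes "subgroup H G" "T \<in> group_vna G H" "s \<in> carrier G" "t \<in> carrier G" "g \<in> carrier G"
  shows "T (delta (t \<otimes> g)) (s \<otimes> g) = T (delta t) s"
  using assms unfolding group_vna_iff[OF assms(1)] by blast

lemma group_vna_op_add:
  assumes H: "subgroup H G" and S: "S \<in> group_vna G H" and T: "T \<in> group_vna G H"
  shows "op_add S T \<in> group_vna G H"
  by (rule group_vnaI[OF H])
    (simp_all add: bounded_ops_op_add group_vna_bounded[OF H S] group_vna_bounded[OF H T], simp_all add: op_add_def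
      group_vna_entry_shift[OF H S] group_vna_entry_shift[OF H T]
      group_vna_entry_zero[OF H S] group_vna_entry_zero[OF H T])

lemma group_vna_op_scale:
  assumes H: "subgroup H G" and T: "T \<in> group_vna G H"
  shows "op_scale c T \<in> group_vna G H"
  by (rule group_vnaI[OF H])
    (simp_all add: bounded_ops_op_scale group_vna_bounded[OF H T], simp_all add: op_scale_def
      group_vna_entry_shift[OF H T] group_vna_entry_zero[OF H T])

section \<open>The conditional expectation onto the algebra of a subgroup\<close>

lemma same_coset_iff:
  assumes H: "subgroup H G" and "s \<in> carrier G" "t \<in> carrier G"
  shows "H #> t = H #> s \<longleftrightarrow> s \<otimes> inv t \<in> H"
  using subgroup.rcos_module[OF H is_group assms(3,2)] repr_independence[OF _ assms(3) H, of s]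
    rcos_self[OF assms(2) H] by blast

definition coset_pinching :: "'a set \<Rightarrow> 'a operator \<Rightarrow> 'a operator" where
  "coset_pinching H = pinching (carrier G) (\<lambda>k. H #> k)"

lemma coset_pinching_bounded:
  "T \<in> bounded_ops (carrier G) \<Longrightarrow> coset_pinching H T \<in> bounded_ops (carrier G)"
  by (simp add: coset_pinching_def pinching_bounded)

lemma coset_pinching_entry:
  assumes "subgroup H G" "T \<in> bounded_ops (carrier G)" "s \<in> carrier G" "t \<in> carrier G"
  shows "coset_pinching H T (delta t) s = (if s \<otimes> inv t \<in> H then T (delta t) s else 0)"
  using assms by (simp add: coset_pinching_def pinching_delta same_coset_iff)

lemma coset_pinching_in_group_vna:
  assumes H: "subgroup H G" and K: "subgroup K G" and T: "T \<in> group_vna G K"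
  shows "coset_pinching H T \<in> group_vna G H"
proof (rule group_vnaI[OF H])
  note B = group_vna_bounded[OF K T]
  show "coset_pinching H T \<in> bounded_ops (carrier G)"
    by (rule coset_pinching_bounded[OF B])
  fix s t assume c: "s \<in> carrier G" "t \<in> carrier G"
  show "coset_pinching H T (delta (t \<otimes> g)) (s \<otimes> g) = coset_pinching H T (delta t) s"
    if "g \<in> carrier G" for g
  proof -
    have "s \<otimes> g \<otimes> inv (t \<otimes> g) = s \<otimes> inv t"
      using c that by (simp add: inv_mult_group m_assoc)
    then show ?thesis
      using c that by (simp add: coset_pinching_entry[OF H B] group_vna_entry_shift[OF K T])
  qed
  show "coset_pinching H T (delta t) s = 0" if "s \<otimes> inv t \<notin> H"
    using c that by (simp add: coset_pinching_entry[OF H B])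
qed

lemma coset_pinching_fixes:
  assumes H: "subgroup H G" and a: "a \<in> group_vna G H"
  shows "coset_pinching H a = a"
proof -
  note B = group_vna_bounded[OF H a]
  show ?thesis
    by (rule bounded_ops_eqI[OF coset_pinching_bounded[OF B] B])
      (simp add: coset_pinching_entry[OF H B] group_vna_entry_zero[OF H a])
qed

lemma group_vna_preserves_cosets:
  assumes H: "subgroup H G" and a: "a \<in> group_vna G H" and \<eta>: "\<eta> \<in> ell2 (carrier G)"
  shows "a (cutoff {s. H #> s = c} \<eta>) = cutoff {s. H #> s = c} (a \<eta>)"
proof -
  note B = group_vna_bounded[OF H a]
  define P where
    "P = (\<lambda>\<xi>. if \<xi> \<in> ell2 (carrier G) then cutoff {s. H #> s = c} \<xi> else (\<lambda>x. 0))"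
  have P: "P \<in> bounded_ops (carrier G)"
    unfolding P_def by (rule cutoff_bounded)
  have P_delta: "P (delta u) = (if H #> u = c then delta u else (\<lambda>x. 0))"
    if "u \<in> carrier G" for u
    using that by (simp add: P_def) (auto simp: cutoff_def delta_def)
  have "a \<circ> P = P \<circ> a"
  proof (rule bounded_ops_eqI[OF bounded_ops_comp[OF B P] bounded_ops_comp[OF P B]])
    fix s t assume st: "s \<in> carrier G" "t \<in> carrier G"
    have "P (a (delta t)) s = (if H #> s = c then a (delta t) s else 0)"
      by (simp add: P_def bounded_ops_ell2[OF B]) (simp add: cutoff_def)
    moreover have "a (delta t) s = 0" if "H #> t \<noteq> H #> s"
      using st that by (intro group_vna_entry_zero[OF H a]) (auto simp: same_coset_iff[OF H])
    ultimately show "(a \<circ> P) (delta t) s = (P \<circ> a) (delta t) s"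
      using st by (auto simp: P_delta bounded_ops_zero[OF B])
  qed
  then have "a (P \<eta>) = P (a \<eta>)"
    by (simp add: fun_eq_iff)
  then show ?thesis
    by (simp add: P_def \<eta> bounded_ops_ell2[OF B])
qed

lemma coset_pinching_bimodule:
  assumes H: "subgroup H G" and a: "a \<in> group_vna G H" and b: "b \<in> group_vna G H"
    and x: "x \<in> bounded_ops (carrier G)"
  shows "coset_pinching H (a \<circ> x \<circ> b) = a \<circ> coset_pinching H x \<circ> b"
  unfolding coset_pinching_def
  by (rule pinching_bimodule)
    (auto intro: group_vna_bounded[OF H] group_vna_preserves_cosets[OF H] a b x)

lemma group_trace_eq: "group_trace G x = x (delta \<one>) \<one>"
  by (simp add: group_trace_def ell2_inner_delta_right)

text \<open>The algebra of \<open>H\<close> preserves the right cosets of \<open>H\<close>, so the general facts on pinchings apply.\<close>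

lemma coset_pinching_is_cond_exp:
  assumes H: "subgroup H G"
  shows "is_cond_exp (carrier G) (group_trace G) (group_vna G (carrier G)) (group_vna G H)
    (restrict (coset_pinching H) (group_vna G (carrier G)))"
proof -
  note GG = subgroup_self
  let ?M = "group_vna G (carrier G)" and ?A = "group_vna G H"
  let ?E = "restrict (coset_pinching H) ?M"
  have A_M: "a \<in> ?M" if "a \<in> ?A" for a
    using group_vna_mono[OF H GG subgroup.subset[OF H]] that by blast
  have M_B: "x \<in> bounded_ops (carrier G)" if "x \<in> ?M" for x
    using group_vna_bounded[OF GG that] .
  show ?thesis
    unfolding is_cond_exp_def
  proof (intro conjI ballI allI impI)
    show "?E \<in> ?M \<rightarrow>\<^sub>E ?A"
      using coset_pinching_in_group_vna[OF H GG] by (simp add: PiE_def Pi_def)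
    show "?E (op_add x y) = op_add (?E x) (?E y)" if "x \<in> ?M" "y \<in> ?M" for x y
    proof -
      have "coset_pinching H (op_add x y) = op_add (coset_pinching H x) (coset_pinching H y)"
        by (intro ext) (simp add: coset_pinching_def pinching_def op_add_def)
      then show ?thesis
        using that group_vna_op_add[OF GG that] by simp
    qed
    show "?E (op_scale c x) = op_scale c (?E x)" if "x \<in> ?M" for c x
    proof -
      have "coset_pinching H (op_scale c x) = op_scale c (coset_pinching H x)"
        by (intro ext) (simp add: coset_pinching_def pinching_def op_scale_def)
      then show ?thesis
        using that group_vna_op_scale[OF GG that] by simp
    qed
    show "op_positive (carrier G) (?E x)" if "x \<in> ?M" "op_positive (carrier G) x" for x
      using that(1) pinching_positive[OF M_B[OF that(1)] that(2)] by (simp add: coset_pinching_def)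
    show "?E a = a" if "a \<in> ?A" for a
      using that by (simp add: A_M coset_pinching_fixes[OF H])
    show "?E (a \<circ> x \<circ> b) = a \<circ> ?E x \<circ> b" if "a \<in> ?A" "b \<in> ?A" "x \<in> ?M" for a b x
    proof -
      have "a \<circ> x \<circ> b \<in> ?M"
        by (intro group_vna_comp[OF GG] A_M that)
      then show ?thesis
        using that coset_pinching_bimodule[OF H that(1,2) M_B[OF that(3)]] by simp
    qed
    show "group_trace G (?E x) = group_trace G x" if "x \<in> ?M" for x
      using that subgroup.one_closed[OF H]
      by (simp add: group_trace_eq coset_pinching_entry[OF H] M_B)
  qed
qed

text \<open>For uniqueness, the trace of \<open>z \<circ> left_regular G h\<close> is the coefficient of \<open>z\<close> at \<open>(\<one>, h)\<close>. An
expectation that preserves the trace and commutes with multiplication by \<open>left_regular G h\<close>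
therefore keeps all these coefficients, and by translation invariance they determine an element
of the algebra of \<open>H\<close>.\<close>

lemma cond_exp_eq_coset_pinching:
  assumes H: "subgroup H G"
  shows "cond_exp (carrier G) (group_trace G) (group_vna G (carrier G)) (group_vna G H)
    = restrict (coset_pinching H) (group_vna G (carrier G))"
  unfolding cond_exp_def
proof (rule the_equality)
  let ?M = "group_vna G (carrier G)" and ?A = "group_vna G H"
  show "is_cond_exp (carrier G) (group_trace G) ?M ?A (restrict (coset_pinching H) ?M)"
    by (rule coset_pinching_is_cond_exp[OF H])
  note GG = subgroup_self
  have A_M: "a \<in> ?M" if "a \<in> ?A" for a
    using group_vna_mono[OF H GG subgroup.subset[OF H]] that by blast
  fix E assume E: "is_cond_exp (carrier G) (group_trace G) ?M ?A E"
  have E_ext: "E \<in> ?M \<rightarrow>\<^sub>E ?A"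
    using E unfolding is_cond_exp_def by blast
  have E_bim: "E (a \<circ> x \<circ> b) = a \<circ> E x \<circ> b" if "a \<in> ?A" "b \<in> ?A" "x \<in> ?M" for a b x
    using E that unfolding is_cond_exp_def by blast
  have E_tr: "group_trace G (E x) = group_trace G x" if "x \<in> ?M" for x
    using E that unfolding is_cond_exp_def by blast
  show "E = restrict (coset_pinching H) ?M"
  proof (rule extensionalityI[of _ ?M])
    fix x assume x: "x \<in> ?M"
    have Ex: "E x \<in> ?A"
      using E_ext x by blast
    have xB: "x \<in> bounded_ops (carrier G)" and ExB: "E x \<in> bounded_ops (carrier G)"
      using group_vna_bounded[OF GG x] group_vna_bounded[OF H Ex] by auto
    have coeff: "E x (delta h) \<one> = x (delta h) \<one>" if h: "h \<in> H" for h
    proof -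
      note one = left_regular_in_group_vna[OF H subgroup.one_closed[OF H]]
      note lh = left_regular_in_group_vna[OF H h]
      have "group_trace G (left_regular G \<one> \<circ> E x \<circ> left_regular G h)
          = group_trace G (E (left_regular G \<one> \<circ> x \<circ> left_regular G h))"
        by (simp only: E_bim[OF one lh x])
      also have "\<dots> = group_trace G (left_regular G \<one> \<circ> x \<circ> left_regular G h)"
        by (intro E_tr group_vna_comp[OF GG] A_M one lh x)
      finally show ?thesis
        using h by (simp add: left_regular_one op_id_comp xB ExB del: comp_apply)
          (simp add: group_trace_eq left_regular_delta subgroup.mem_carrier[OF H])
    qed
    have "E x = coset_pinching H x"
    proof (rule bounded_ops_eqI[OF ExB coset_pinching_bounded[OF xB]])
      fix s t assume st: "s \<in> carrier G" "t \<in> carrier G"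
      show "E x (delta t) s = coset_pinching H x (delta t) s"
      proof (cases "s \<otimes> inv t \<in> H")
        case True
        then have h: "t \<otimes> inv s \<in> H"
          using subgroup.m_inv_closed[OF H True] st by (simp add: inv_mult_group)
        have "E x (delta t) s = E x (delta (t \<otimes> inv s \<otimes> s)) (\<one> \<otimes> s)"
          using st by (simp add: m_assoc)
        also have "\<dots> = x (delta (t \<otimes> inv s \<otimes> s)) (\<one> \<otimes> s)"
          using st coeff[OF h] 
          by (simp only: group_vna_entry_shift[OF H Ex] group_vna_entry_shift[OF GG x]
              one_closed m_closed inv_closed)
        finally show ?thesis
          using st True by (simp add: coset_pinching_entry[OF H xB] m_assoc)
      qed (use st in \<open>simp add: coset_pinching_entry[OF H xB] group_vna_entry_zero[OF H Ex]\<close>)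
    qed
    then show "E x = restrict (coset_pinching H) ?M x"
      using x by simp
  qed (use E_ext in \<open>auto simp: PiE_def\<close>)
qed

lemma cond_exp_kernel_iff:
  assumes H: "subgroup H G"
  shows "x \<in> cond_exp_kernel (carrier G) (group_trace G) (group_vna G (carrier G)) (group_vna G H)
    \<longleftrightarrow> x \<in> group_vna G (carrier G) \<and> (\<forall>h\<in>H. x (delta \<one>) h = 0)"
proof (cases "x \<in> group_vna G (carrier G)")
  case x: True
  note GG = subgroup_self
  note B = group_vna_bounded[OF GG x]
  have zero: "op_zero \<in> bounded_ops (carrier G)"
    by (rule bounded_opsI[where K = 0]) (auto simp: op_zero_def ell2_norm_def)
  have "coset_pinching H x = op_zero \<longleftrightarrow> (\<forall>h\<in>H. x (delta \<one>) h = 0)"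
  proof
    assume eq: "coset_pinching H x = op_zero"
    show "\<forall>h\<in>H. x (delta \<one>) h = 0"
    proof
      fix h assume h: "h \<in> H"
      then show "x (delta \<one>) h = 0"
        using coset_pinching_entry[OF H B, of h \<one>] subgroup.mem_carrier[OF H h]
        by (simp add: eq op_zero_def)
    qed
  next
    assume vanish: "\<forall>h\<in>H. x (delta \<one>) h = 0"
    show "coset_pinching H x = op_zero"
    proof (rule bounded_ops_eqI[OF coset_pinching_bounded[OF B] zero])
      fix s t assume st: "s \<in> carrier G" "t \<in> carrier G"
      show "coset_pinching H x (delta t) s = op_zero (delta t) s"
        using vanish group_vna_entry_eq_one[OF GG x st]
        by (simp add: coset_pinching_entry[OF H B st] op_zero_def)
    qed
  qed
  then show ?thesis
    using x by (simp add: cond_exp_kernel_def cond_exp_eq_coset_pinching[OF H])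
qed (simp add: cond_exp_kernel_def)

lemma coset_pinching_delta_one:
  assumes H: "subgroup H G" and B: "x \<in> bounded_ops (carrier G)"
  shows "coset_pinching H x (delta \<one>) = cutoff H (x (delta \<one>))"
proof
  fix k
  show "coset_pinching H x (delta \<one>) k = cutoff H (x (delta \<one>)) k"
  proof (cases "k \<in> carrier G")
    case True
    then show ?thesis
      by (simp add: coset_pinching_entry[OF H B] cutoff_def)
  next
    case False
    then show ?thesis
      using ell2_zero_off[OF bounded_ops_ell2[OF B]]
        ell2_zero_off[OF bounded_ops_ell2[OF coset_pinching_bounded[OF B]]]
      by (simp add: cutoff_def)
  qed
qed

lemma trace_norm2_eq:
  assumes "x \<in> bounded_ops (carrier G)"
  shows "trace_norm2 (carrier G) (group_trace G) x = ell2_norm (carrier G) (x (delta \<one>))"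
proof -
  have "ell2_inner (carrier G) (op_adj (carrier G) x (x (delta \<one>))) (delta \<one>)
      = of_real ((ell2_norm (carrier G) (x (delta \<one>)))\<^sup>2)"
    by (simp add: inner_adj_left[OF assms] bounded_ops_ell2[OF assms] ell2_inner_self)
  then show ?thesis
    by (simp add: trace_norm2_def group_trace_def)
qed

text \<open>With \<open>w = x\<^sup>* v y\<close>, the bimodule property gives \<open>E(w v\<^sup>*) = E(w) v\<^sup>* = v\<^sup>* E(w)\<close>, the last step
because the algebra of \<open>H\<close> is abelian; and \<open>v\<^sup>*\<close> is isometric.\<close>

lemma mixing_norm_eq:
  assumes H: "subgroup H G" and comm: "\<And>g h. g \<in> H \<Longrightarrow> h \<in> H \<Longrightarrow> g \<otimes> h = h \<otimes> g"
    and x: "x \<in> group_vna G (carrier G)" and y: "y \<in> group_vna G (carrier G)"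
    and v: "v \<in> carrier (unitary_group (carrier G) (group_vna G H))"
  shows "trace_norm2 (carrier G) (group_trace G)
      (cond_exp (carrier G) (group_trace G) (group_vna G (carrier G)) (group_vna G H)
        (op_adj (carrier G) x \<circ> conj_action (carrier G) v y))
    = ell2_norm (carrier G) (cutoff H (op_adj (carrier G) x (v (y (delta \<one>)))))"
proof -
  note GG = subgroup_self
  let ?M = "group_vna G (carrier G)" and ?A = "group_vna G H"
  define w where "w = op_adj (carrier G) x \<circ> (v \<circ> y)"
  define v' where "v' = op_adj (carrier G) v"
  have vA: "v \<in> ?A" and vv: "v \<circ> v' = op_id (carrier G)"
    using v by (auto simp: unitary_group_def v'_def)
  have v'A: "v' \<in> ?A"
    unfolding v'_def by (rule group_vna_adj[OF H vA])
  have A_M: "a \<in> ?M" if "a \<in> ?A" for a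
    using group_vna_mono[OF H GG subgroup.subset[OF H]] that by blast
  have w: "w \<in> ?M"
    unfolding w_def by (intro group_vna_comp[OF GG] group_vna_adj[OF GG] x y A_M vA)
  note wB = group_vna_bounded[OF GG w] and vB = group_vna_bounded[OF H vA]
    and v'B = group_vna_bounded[OF H v'A]
  have Ew: "coset_pinching H w \<in> ?A"
    by (rule coset_pinching_in_group_vna[OF H GG w])
  have one: "op_id (carrier G) \<in> ?A"
    using left_regular_in_group_vna[OF H subgroup.one_closed[OF H]] by (simp add: left_regular_one)
  have "op_adj (carrier G) x \<circ> conj_action (carrier G) v y = w \<circ> v'"
    by (simp add: w_def v'_def conj_action_def comp_assoc)
  moreover have "w \<circ> v' \<in> ?M"
    by (intro group_vna_comp[OF GG] w A_M v'A)
  moreover have "coset_pinching H (w \<circ> v') = v' \<circ> coset_pinching H w"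
  proof -
    have "coset_pinching H (op_id (carrier G) \<circ> w \<circ> v') = op_id (carrier G) \<circ> coset_pinching H w \<circ> v'"
      by (rule coset_pinching_bimodule[OF H one v'A wB])
    then have "coset_pinching H (w \<circ> v') = coset_pinching H w \<circ> v'"
      by (simp only: op_id_comp[OF wB] op_id_comp[OF coset_pinching_bounded[OF wB]])
    also have "\<dots> = v' \<circ> coset_pinching H w"
      by (rule group_vna_commute[OF H comm Ew v'A])
    finally show ?thesis .
  qed
  ultimately have "trace_norm2 (carrier G) (group_trace G)
      (cond_exp (carrier G) (group_trace G) ?M ?A (op_adj (carrier G) x \<circ> conj_action (carrier G) v y))
    = trace_norm2 (carrier G) (group_trace G) (v' \<circ> coset_pinching H w)"
    by (simp add: cond_exp_eq_coset_pinching[OF H])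
  also have "\<dots> = ell2_norm (carrier G) (v' (coset_pinching H w (delta \<one>)))"
    using trace_norm2_eq[OF bounded_ops_comp[OF v'B coset_pinching_bounded[OF wB]]] by simp
  also have "\<dots> = ell2_norm (carrier G) (coset_pinching H w (delta \<one>))"
    using coisometry_adj_norm[OF vB] vv unfolding v'_def
    by (simp add: bounded_ops_ell2[OF coset_pinching_bounded[OF wB]])
  also have "coset_pinching H w (delta \<one>) = cutoff H (w (delta \<one>))"
    by (rule coset_pinching_delta_one[OF H wB])
  also have "w (delta \<one>) = op_adj (carrier G) x (v (y (delta \<one>)))"
    by (simp add: w_def)
  finally show ?thesis .
qed

section \<open>Weak mixing and condition SS\<close>

lemma left_regular_unitary:
  assumes H: "subgroup H G" and h: "h \<in> H"
  shows "left_regular G h \<in> carrier (unitary_group (carrier G) (group_vna G H))"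
  using left_regular_in_group_vna[OF H h] subgroup.mem_carrier[OF H h]
  by (simp add: unitary_group_def left_regular_adj left_regular_mult left_regular_one)

lemma left_regular_subgroup:
  assumes H: "subgroup H G"
  shows "subgroup (left_regular G ` H) (unitary_group (carrier G) (group_vna G H))"
    (is "subgroup _ ?U")
proof
  note Hc = subgroup.mem_carrier[OF H]
  show "left_regular G ` H \<subseteq> carrier ?U"
    using left_regular_unitary[OF H] by blast
  show "\<one>\<^bsub>?U\<^esub> \<in> left_regular G ` H"
    using imageI[OF subgroup.one_closed[OF H], of "left_regular G"]
    by (simp add: unitary_group_def left_regular_one)
  show "x \<otimes>\<^bsub>?U\<^esub> y \<in> left_regular G ` H"
    if xy: "x \<in> left_regular G ` H" "y \<in> left_regular G ` H" for x y
  proof -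
    obtain g h where "g \<in> H" "x = left_regular G g" "h \<in> H" "y = left_regular G h"
      using xy by blast
    then have "x \<otimes>\<^bsub>?U\<^esub> y = left_regular G (g \<otimes> h)" "g \<otimes> h \<in> H"
      by (simp_all add: unitary_group_def left_regular_mult Hc subgroup.m_closed[OF H])
    then show ?thesis by simp
  qed
  show "inv\<^bsub>?U\<^esub> x \<in> left_regular G ` H" if x: "x \<in> left_regular G ` H" for x
  proof -
    obtain h where h: "h \<in> H" and x: "x = left_regular G h"
      using x by blast
    have h': "inv h \<in> H"
      by (rule subgroup.m_inv_closed[OF H h])
    have "inv\<^bsub>?U\<^esub> x = left_regular G (inv h)"
      unfolding m_inv_def[of ?U]
    proof (rule the_equality)
      show "left_regular G (inv h) \<in> carrier ?U \<and> x \<otimes>\<^bsub>?U\<^esub> left_regular G (inv h) = \<one>\<^bsub>?U\<^esub> \<and>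
          left_regular G (inv h) \<otimes>\<^bsub>?U\<^esub> x = \<one>\<^bsub>?U\<^esub>"
        using left_regular_unitary[OF H h'] h
        by (simp add: x unitary_group_def left_regular_mult left_regular_one Hc)
    next
      fix y assume y: "y \<in> carrier ?U \<and> x \<otimes>\<^bsub>?U\<^esub> y = \<one>\<^bsub>?U\<^esub> \<and> y \<otimes>\<^bsub>?U\<^esub> x = \<one>\<^bsub>?U\<^esub>"
      then have yB: "y \<in> bounded_ops (carrier G)"
        using group_vna_bounded[OF H] by (simp add: unitary_group_def)
      have "y = y \<circ> (x \<circ> left_regular G (inv h))"
        using h yB by (simp add: x left_regular_mult left_regular_one op_id_comp Hc)
      also have "\<dots> = op_id (carrier G) \<circ> left_regular G (inv h)"
        using y by (simp add: unitary_group_def flip: comp_assoc)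
      also have "\<dots> = left_regular G (inv h)"
        by (rule op_id_comp(1)[OF left_regular_bounded[OF Hc[OF h']]])
      finally show "y = left_regular G (inv h)" .
    qed
    then show ?thesis
      using h' by simp
  qed
qed

text \<open>The value of \<open>x\<^sup>* \<delta>\<^sub>u\<close> at \<open>k\<close> is the conjugate of the value of \<open>x \<delta>\<^sub>1\<close> at \<open>u k\<inverse>\<close>, and for
different \<open>k \<in> H\<close> these are different points outside \<open>D\<close>.\<close>

lemma cutoff_adj_delta_norm_le:
  assumes x: "x \<in> group_vna G (carrier G)" and H: "subgroup H G" and u: "u \<in> carrier G"
    and avoid: "\<And>k. k \<in> H \<Longrightarrow> u \<otimes> inv k \<notin> D"
  shows "ell2_norm (carrier G) (cutoff H (op_adj (carrier G) x (delta u)))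
    \<le> ell2_norm (carrier G) (cutoff (- D) (x (delta \<one>)))"
proof -
  note GG = subgroup_self and Hc = subgroup.mem_carrier[OF H]
  note B = group_vna_bounded[OF GG x]
  define \<xi> where "\<xi> = cutoff (- D) (x (delta \<one>))"
  have \<xi>: "\<xi> \<in> ell2 (carrier G)"
    unfolding \<xi>_def by (intro ell2_cutoff bounded_ops_ell2[OF B])
  have bij: "bij_betw (\<lambda>k. u \<otimes> inv k) (carrier G) (carrier G)"
    by (rule bij_betw_byWitness[where f' = "\<lambda>s. inv s \<otimes> u"]) (use u in \<open>auto simp: inv_mult_group m_assoc\<close>)
  let ?T = "translation (carrier G) (\<lambda>k. u \<otimes> inv k) \<xi>"
  have "cmod (cutoff H (op_adj (carrier G) x (delta u)) k) \<le> cmod (?T k)" for k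
  proof (cases "k \<in> H")
    case True
    then have k: "k \<in> carrier G" by (rule Hc)
    have "op_adj (carrier G) x (delta u) k = cnj (x (delta \<one>) (u \<otimes> inv k))"
      using op_adj_entry[OF B k u] group_vna_entry_eq_one[OF GG x u k] by simp
    then show ?thesis
      using True k avoid[OF True] by (simp add: cutoff_def translation_def \<xi>) (simp add: \<xi>_def cutoff_def)
  qed (simp add: cutoff_def)
  then have "ell2_norm (carrier G) (cutoff H (op_adj (carrier G) x (delta u)))
      \<le> ell2_norm (carrier G) ?T"
    by (rule ell2_norm_mono[OF translation_ell2(1)[OF bij \<xi>]])
  then show ?thesis
    unfolding translation_ell2(2)[OF bij \<xi>] unfolding \<xi>_def .
qed

text \<open>Split \<open>y \<delta>\<^sub>1\<close> into a part on the finite set \<open>C\<close> and a tail. The tail is harmless since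
\<open>x\<^sup>* \<lambda>(\<gamma>)\<close> is bounded uniformly in \<open>\<gamma>\<close>. On the finite part each \<open>\<delta>\<^sub>g\<close> is moved to
\<open>\<delta>\<^bsub>\<gamma>g\<^esub>\<close>, and \<open>\<gamma>\<close> is chosen so that only the tail of \<open>x \<delta>\<^sub>1\<close> outside \<open>D\<close> is seen.\<close>

lemma SS_imp_weakly_mixing_action:
  assumes H: "subgroup H G" and comm: "\<And>g h. g \<in> H \<Longrightarrow> h \<in> H \<Longrightarrow> g \<otimes> h = h \<otimes> g"
    and SS: "condition_SS G H"
  shows "weakly_mixing_action (carrier G) (group_trace G) (group_vna G (carrier G)) (group_vna G H)
    (left_regular G ` H)"
  unfolding weakly_mixing_action_def
proof (intro allI impI)
  note GG = subgroup_self and Hc = subgroup.mem_carrier[OF H]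
  let ?M = "group_vna G (carrier G)" and ?A = "group_vna G H"
  let ?N = "ell2_norm (carrier G)"
  fix F :: "'a operator set" and \<epsilon> :: real
  assume "finite F \<and> F \<subseteq> cond_exp_kernel (carrier G) (group_trace G) ?M ?A \<and> \<epsilon> > 0"
  then have F: "finite F" and \<epsilon>: "\<epsilon> > 0"
    and FM: "\<And>x. x \<in> F \<Longrightarrow> x \<in> ?M" and F0: "\<And>x h. x \<in> F \<Longrightarrow> h \<in> H \<Longrightarrow> x (delta \<one>) h = 0"
    by (auto simp: cond_exp_kernel_iff[OF H])
  have FB: "x \<in> bounded_ops (carrier G)" if "x \<in> F" for x
    by (rule group_vna_bounded[OF GG FM[OF that]])
  define V where "V = (\<lambda>x. x (delta \<one>)) ` F"
  have V: "finite V" "V \<subseteq> ell2 (carrier G)" "\<forall>\<xi>\<in>V. \<forall>h\<in>H. \<xi> h = 0"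
    using F F0 bounded_ops_ell2[OF FB] by (auto simp: V_def)
  obtain K where K: "K \<ge> 0"
    and K_bound: "\<forall>T\<in>op_adj (carrier G) ` F. \<forall>\<xi>\<in>ell2 (carrier G). ?N (T \<xi>) \<le> K * ?N \<xi>"
    by (rule finite_common_bound[OF finite_imageI[OF F] image_subsetI[OF bounded_ops_adj[OF FB]]])
  have \<epsilon>K: "0 < \<epsilon> / (2 * (K + 1))"
    using K \<epsilon> by simp
  obtain C where C: "finite C" "C \<subseteq> carrier G - H"
    and C_tail: "\<forall>\<xi>\<in>V. ?N (cutoff (- C) \<xi>) \<le> \<epsilon> / (2 * (K + 1))"
    by (rule finite_common_truncation[OF V(1,2) \<epsilon>K V(3)])
  \<comment> \<open>The tolerance for \<open>D\<close> must beat the total mass \<open>L\<close> of the finite parts, so \<open>C\<close> comes first.\<close>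
  define L where "L = (\<Sum>\<xi>\<in>V. \<Sum>g\<in>C. cmod (\<xi> g))"
  have L: "L \<ge> 0"
    by (simp add: L_def sum_nonneg)
  have \<epsilon>L: "0 < \<epsilon> / (2 * (L + 1))"
    using L \<epsilon> by simp
  obtain D where D: "finite D" "D \<subseteq> carrier G - H"
    and D_tail: "\<forall>\<xi>\<in>V. ?N (cutoff (- D) \<xi>) \<le> \<epsilon> / (2 * (L + 1))"
    by (rule finite_common_truncation[OF V(1,2) \<epsilon>L V(3)])
  have inv_D: "inv d \<notin> H" if "d \<in> D" for d
    using subgroup.m_inv_closed[OF H, of "inv d"] D(2) that by auto
  have "finite (C \<union> m_inv G ` D) \<and> C \<union> m_inv G ` D \<subseteq> carrier G - H"
    using C D inv_D by auto
  with SS have "\<exists>\<gamma>\<in>H. \<forall>g\<in>C \<union> m_inv G ` D. \<forall>h\<in>C \<union> m_inv G ` D. g \<otimes> \<gamma> \<otimes> h \<notin> H"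
    unfolding condition_SS_def by (elim allE impE)
  then obtain \<gamma> where \<gamma>: "\<gamma> \<in> H"
    and SS_\<gamma>: "\<And>g h. g \<in> C \<union> m_inv G ` D \<Longrightarrow> h \<in> C \<union> m_inv G ` D \<Longrightarrow> g \<otimes> \<gamma> \<otimes> h \<notin> H"
    by blast
  note \<gamma>c = Hc[OF \<gamma>]
  have avoid: "\<gamma> \<otimes> g \<otimes> inv k \<notin> D" if g: "g \<in> C" and k: "k \<in> H" for g k
  proof
    assume d: "\<gamma> \<otimes> g \<otimes> inv k \<in> D"
    have "inv (\<gamma> \<otimes> g \<otimes> inv k) \<otimes> \<gamma> \<otimes> g = k"
      using subsetD[OF C(2) g] \<gamma>c Hc[OF k] by (simp add: inv_mult_group m_assoc)
    then show False
      using SS_\<gamma>[of "inv (\<gamma> \<otimes> g \<otimes> inv k)" g] d g k by simp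
  qed
  show "\<exists>v\<in>left_regular G ` H. \<forall>x\<in>F. \<forall>y\<in>F. trace_norm2 (carrier G) (group_trace G)
      (cond_exp (carrier G) (group_trace G) ?M ?A (op_adj (carrier G) x \<circ> conj_action (carrier G) v y)) \<le> \<epsilon>"
  proof (intro bexI ballI)
    show "left_regular G \<gamma> \<in> left_regular G ` H"
      using \<gamma> by blast
    fix x y assume x: "x \<in> F" and y: "y \<in> F"
    define \<eta> where "\<eta> = y (delta \<one>)"
    have \<eta>V: "\<eta> \<in> V" and \<eta>: "\<eta> \<in> ell2 (carrier G)"
      using y bounded_ops_ell2[OF FB[OF y]] by (auto simp: \<eta>_def V_def)
    define T where "T = op_adj (carrier G) x \<circ> left_regular G \<gamma>"
    have TB: "T \<in> bounded_ops (carrier G)"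
      unfolding T_def by (intro bounded_ops_comp bounded_ops_adj FB x left_regular_bounded \<gamma>c)
    have T_bound: "?N (T \<xi>) \<le> K * ?N \<xi>" if "\<xi> \<in> ell2 (carrier G)" for \<xi>
    proof -
      have "?N (T \<xi>) \<le> K * ?N (left_regular G \<gamma> \<xi>)"
        using K_bound x bounded_ops_ell2[OF left_regular_bounded[OF \<gamma>c]] by (simp add: T_def)
      also have "?N (left_regular G \<gamma> \<xi>) = ?N \<xi>"
        unfolding left_regular_translation
        by (rule translation_ell2(2)[OF left_mult_bij that]) (simp add: \<gamma>c)
      finally show ?thesis .
    qed
    have T_delta: "?N (cutoff H (T (delta g))) \<le> \<epsilon> / (2 * (L + 1))" if g: "g \<in> C" for g
    proof -
      have gc: "g \<in> carrier G"
        using g C(2) by blast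
      have "?N (cutoff H (T (delta g))) \<le> ?N (cutoff (- D) (x (delta \<one>)))"
        using cutoff_adj_delta_norm_le[OF FM[OF x] H _ avoid[OF g]] \<gamma>c gc
        by (simp add: T_def left_regular_delta)
      also have "\<dots> \<le> \<epsilon> / (2 * (L + 1))"
        using x by (intro D_tail[rule_format]) (simp add: V_def)
      finally show ?thesis .
    qed
    have "T \<eta> = (\<lambda>s. T (cutoff C \<eta>) s + T (cutoff (- C) \<eta>) s)"
      using bounded_ops_add[OF TB ell2_cutoff[OF \<eta>] ell2_cutoff[OF \<eta>], of C "- C"] cutoff_split[of \<eta> C]
      by simp
    moreover have "T (cutoff C \<eta>) = (\<lambda>s. \<Sum>g\<in>C. \<eta> g * T (delta g) s)"
      unfolding cutoff_finite_eq_sum[OF C(1)] using C(2)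
      by (intro bounded_ops_sum[OF TB]) auto
    ultimately have split: "cutoff H (T \<eta>)
        = (\<lambda>s. (\<Sum>g\<in>C. \<eta> g * cutoff H (T (delta g)) s) + cutoff H (T (cutoff (- C) \<eta>)) s)"
      by (auto simp: cutoff_def)
    have cT: "cutoff H (T \<xi>) \<in> ell2 (carrier G)" for \<xi>
      by (intro ell2_cutoff bounded_ops_ell2[OF TB])
    have "?N (cutoff H (T \<eta>)) \<le> ?N (\<lambda>s. \<Sum>g\<in>C. \<eta> g * cutoff H (T (delta g)) s) + ?N (cutoff H (T (cutoff (- C) \<eta>)))"
      unfolding split by (intro ell2_norm_triangle ell2_sum_closed ell2_scale_closed cT)
    also have "?N (\<lambda>s. \<Sum>g\<in>C. \<eta> g * cutoff H (T (delta g)) s) \<le> \<epsilon> / 2"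
    proof -
      have "?N (\<lambda>s. \<Sum>g\<in>C. \<eta> g * cutoff H (T (delta g)) s)
          \<le> (\<Sum>g\<in>C. ?N (\<lambda>s. \<eta> g * cutoff H (T (delta g)) s))"
        by (intro ell2_norm_sum_le ell2_scale_closed cT)
      also have "\<dots> \<le> (\<Sum>g\<in>C. cmod (\<eta> g) * (\<epsilon> / (2 * (L + 1))))"
        unfolding ell2_norm_scale by (intro sum_mono mult_left_mono T_delta) auto
      also have "\<dots> = (\<Sum>g\<in>C. cmod (\<eta> g)) * (\<epsilon> / (2 * (L + 1)))"
        by (rule sum_distrib_right[symmetric])
      also have "\<dots> \<le> L * (\<epsilon> / (2 * (L + 1)))"
        unfolding L_def using V(1) \<eta>V \<epsilon> L
        by (intro mult_right_mono member_le_sum) (auto simp: sum_nonneg L_def)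
      also have "\<dots> \<le> \<epsilon> / 2"
        using L \<epsilon> by (simp add: field_simps)
      finally show ?thesis .
    qed
    also have "?N (cutoff H (T (cutoff (- C) \<eta>))) \<le> \<epsilon> / 2"
    proof -
      have "?N (cutoff H (T (cutoff (- C) \<eta>))) \<le> ?N (T (cutoff (- C) \<eta>))"
        by (intro ell2_norm_cutoff_le bounded_ops_ell2[OF TB])
      also have "\<dots> \<le> K * ?N (cutoff (- C) \<eta>)"
        by (intro T_bound ell2_cutoff \<eta>)
      also have "\<dots> \<le> K * (\<epsilon> / (2 * (K + 1)))"
        by (intro mult_left_mono C_tail[rule_format] \<eta>V K)
      also have "\<dots> \<le> \<epsilon> / 2"
        using K \<epsilon> by (simp add: field_simps)
      finally show ?thesis .
    qed
    finally have "?N (cutoff H (T \<eta>)) \<le> \<epsilon>"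
      by simp
    then show "trace_norm2 (carrier G) (group_trace G)
        (cond_exp (carrier G) (group_trace G) ?M ?A
          (op_adj (carrier G) x \<circ> conj_action (carrier G) (left_regular G \<gamma>) y)) \<le> \<epsilon>"
      using mixing_norm_eq[OF H comm FM[OF x] FM[OF y] left_regular_unitary[OF H \<gamma>]]
      by (simp add: T_def \<eta>_def)
  qed
qed

text \<open>The vector \<open>left_regular G g (v \<delta>\<^sub>h)\<close> takes at \<open>g \<gamma> h\<close> the value of \<open>v \<delta>\<^sub>1\<close> at \<open>\<gamma>\<close>.\<close>

lemma cutoff_norm_le_mixing_coefficient:
  assumes H: "subgroup H G" and v: "v \<in> group_vna G H" and g: "g \<in> carrier G" and h: "h \<in> carrier G"
  shows "ell2_norm (carrier G) (cutoff {\<gamma>. g \<otimes> \<gamma> \<otimes> h \<in> H} (v (delta \<one>)))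
    \<le> ell2_norm (carrier G) (cutoff H (left_regular G g (v (delta h))))"
proof -
  note vB = group_vna_bounded[OF H v]
  define \<theta> where "\<theta> = cutoff H (left_regular G g (v (delta h)))"
  have \<theta>: "\<theta> \<in> ell2 (carrier G)"
    unfolding \<theta>_def by (intro ell2_cutoff bounded_ops_ell2[OF left_regular_bounded[OF g]])
  have bij: "bij_betw (\<lambda>\<gamma>. g \<otimes> \<gamma> \<otimes> h) (carrier G) (carrier G)"
    by (rule bij_betw_byWitness[where f' = "\<lambda>s. inv g \<otimes> s \<otimes> inv h"])
      (use g h in \<open>auto simp: m_assoc\<close>)
  let ?T = "translation (carrier G) (\<lambda>\<gamma>. g \<otimes> \<gamma> \<otimes> h) \<theta>"
  have "cmod (cutoff {\<gamma>. g \<otimes> \<gamma> \<otimes> h \<in> H} (v (delta \<one>)) \<gamma>) \<le> cmod (?T \<gamma>)" for \<gamma>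
  proof (cases "\<gamma> \<in> carrier G \<and> g \<otimes> \<gamma> \<otimes> h \<in> H")
    case True
    have "left_regular G g (v (delta h)) (g \<otimes> \<gamma> \<otimes> h) = v (delta h) (\<gamma> \<otimes> h)"
      using True g h by (simp add: left_regular_apply bounded_ops_ell2[OF vB] m_assoc)
    also have "\<dots> = v (delta \<one>) \<gamma>"
      using group_vna_entry_shift[OF H v, of \<gamma> \<one> h] True h by simp
    finally show ?thesis
      using True by (simp add: translation_def \<theta>) (simp add: \<theta>_def cutoff_def)
  next
    case False
    then show ?thesis
      using ell2_zero_off[OF bounded_ops_ell2[OF vB]] by (auto simp: cutoff_def)
  qed
  then have "ell2_norm (carrier G) (cutoff {\<gamma>. g \<otimes> \<gamma> \<otimes> h \<in> H} (v (delta \<one>))) \<le> ell2_norm (carrier G) ?T"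
    by (rule ell2_norm_mono[OF translation_ell2(1)[OF bij \<theta>]])
  then show ?thesis
    unfolding translation_ell2(2)[OF bij \<theta>] unfolding \<theta>_def .
qed

lemma unitary_vector_norm:
  assumes H: "subgroup H G" and v: "v \<in> carrier (unitary_group (carrier G) (group_vna G H))"
  shows "ell2_norm (carrier G) (v (delta \<one>)) = 1"
proof -
  have vA: "v \<in> group_vna G H" and vv: "op_adj (carrier G) v \<circ> v = op_id (carrier G)"
    using v by (auto simp: unitary_group_def)
  note B = group_vna_bounded[OF H vA]
  have "ell2_norm (carrier G) (op_adj (carrier G) (op_adj (carrier G) v) (delta \<one>))
      = ell2_norm (carrier G) (delta \<one>)"
    using vv by (intro coisometry_adj_norm bounded_ops_adj B) (simp_all add: op_adj_adj B)
  also have "\<dots> = 1"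
  proof -
    have "complex_of_real ((ell2_norm (carrier G) (delta \<one>))\<^sup>2) = of_real 1"
      using ell2_inner_self[of "delta \<one>" "carrier G"]
      by (simp add: ell2_inner_delta_right) (simp add: delta_def)
    then have "(ell2_norm (carrier G) (delta \<one>))\<^sup>2 = 1"
      by (simp only: of_real_eq_iff)
    then show ?thesis
      using ell2_norm_nonneg[of "carrier G" "delta \<one>"] by (simp add: power2_eq_1_iff)
  qed
  finally show ?thesis
    by (simp add: op_adj_adj B)
qed

text \<open>If \<open>C\<close> is a counterexample, the sets \<open>{\<gamma>. g \<gamma> h \<in> H}\<close> with \<open>g, h \<in> C\<close> cover \<open>H\<close>. Then \<open>v \<delta>\<^sub>1\<close>
is dominated by the sum of its restrictions to them, so the norms of these restrictions add up to
at least 1; weak mixing makes their sum less than 1.\<close>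

lemma weakly_mixing_action_imp_SS:
  assumes H: "subgroup H G" and comm: "\<And>g h. g \<in> H \<Longrightarrow> h \<in> H \<Longrightarrow> g \<otimes> h = h \<otimes> g"
    and V: "V \<subseteq> carrier (unitary_group (carrier G) (group_vna G H))"
    and wm: "weakly_mixing_action (carrier G) (group_trace G) (group_vna G (carrier G)) (group_vna G H) V"
  shows "condition_SS G H"
proof (rule ccontr)
  note GG = subgroup_self
  let ?M = "group_vna G (carrier G)" and ?A = "group_vna G H"
  let ?N = "ell2_norm (carrier G)"
  assume "\<not> condition_SS G H"
  then have "\<exists>C. (finite C \<and> C \<subseteq> carrier G - H) \<and> (\<forall>\<gamma>\<in>H. \<exists>g\<in>C. \<exists>h\<in>C. g \<otimes> \<gamma> \<otimes> h \<in> H)"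
    by (simp only: condition_SS_def not_all not_imp ball_simps bex_simps not_not)
  then obtain C where C: "finite C" "C \<subseteq> carrier G - H"
    and hit: "\<forall>\<gamma>\<in>H. \<exists>g\<in>C. \<exists>h\<in>C. g \<otimes> \<gamma> \<otimes> h \<in> H"
    by (elim exE conjE)
  have Cc: "g \<in> carrier G" if "g \<in> C" for g
    using C(2) that by blast
  have inv_C: "inv g \<notin> H" if "g \<in> C" for g
    using subgroup.m_inv_closed[OF H, of "inv g"] C(2) that by auto
  \<comment> \<open>The adjoint in the mixing coefficient turns \<open>left_regular G (inv g)\<close> into \<open>left_regular G g\<close>.\<close>
  define F where "F = left_regular G ` (C \<union> m_inv G ` C)"
  have kernel: "left_regular G g \<in> cond_exp_kernel (carrier G) (group_trace G) ?M ?A"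
    if "g \<in> carrier G" "g \<notin> H" for g
    using that left_regular_in_group_vna[OF GG that(1)]
    by (simp add: cond_exp_kernel_iff[OF H] left_regular_delta) (auto simp: delta_def)
  have F: "finite F" "F \<subseteq> cond_exp_kernel (carrier G) (group_trace G) ?M ?A"
  proof -
    show "finite F"
      using C(1) by (simp add: F_def)
    show "F \<subseteq> cond_exp_kernel (carrier G) (group_trace G) ?M ?A"
      unfolding F_def
    proof (rule image_subsetI, rule kernel)
      fix g assume "g \<in> C \<union> m_inv G ` C"
      then show "g \<in> carrier G" "g \<notin> H"
        using C(2) inv_C by auto
    qed
  qed
  define P where "P = C \<times> C"
  have P: "finite P"
    using C(1) by (simp add: P_def)
  \<comment> \<open>Small enough that \<open>card P\<close> restrictions of norm at most \<open>\<epsilon>\<close> cannot add up to 1.\<close>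
  define \<epsilon> :: real where "\<epsilon> = 1 / (real (card P) + 1)"
  have \<epsilon>: "\<epsilon> > 0"
    by (simp add: \<epsilon>_def)
  obtain v where v: "v \<in> V" and small: "\<forall>x\<in>F. \<forall>y\<in>F.
      trace_norm2 (carrier G) (group_trace G)
        (cond_exp (carrier G) (group_trace G) ?M ?A (op_adj (carrier G) x \<circ> conj_action (carrier G) v y)) \<le> \<epsilon>"
  proof -
    have "finite F \<and> F \<subseteq> cond_exp_kernel (carrier G) (group_trace G) ?M ?A \<and> \<epsilon> > 0"
      using F \<epsilon> by simp
    then have "\<exists>v\<in>V. \<forall>x\<in>F. \<forall>y\<in>F. trace_norm2 (carrier G) (group_trace G)
        (cond_exp (carrier G) (group_trace G) ?M ?A (op_adj (carrier G) x \<circ> conj_action (carrier G) v y)) \<le> \<epsilon>"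
      using wm unfolding weakly_mixing_action_def by (elim allE impE)
    then show thesis
      using that by (elim bexE)
  qed
  have vU: "v \<in> carrier (unitary_group (carrier G) ?A)" and vA: "v \<in> ?A"
    using subsetD[OF V v] by (simp_all add: unitary_group_def)
  define \<nu> where "\<nu> = v (delta \<one>)"
  have \<nu>: "\<nu> \<in> ell2 (carrier G)"
    unfolding \<nu>_def by (rule bounded_ops_ell2[OF group_vna_bounded[OF H vA]])
  have \<nu>_supp: "\<nu> \<gamma> = 0" if "\<gamma> \<notin> H" for \<gamma>
  proof (cases "\<gamma> \<in> carrier G")
    case True
    then show ?thesis
      using group_vna_entry_zero[OF H vA True, of \<one>] that by (simp add: \<nu>_def)
  qed (rule ell2_zero_off[OF \<nu>])
  define B where "B = (\<lambda>(g, h). {\<gamma>. g \<otimes> \<gamma> \<otimes> h \<in> H})"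
  have piece: "?N (cutoff (B p) \<nu>) \<le> \<epsilon>" if pP: "p \<in> P" for p
  proof -
    obtain g h where p: "p = (g, h)" "g \<in> C" "h \<in> C"
      using pP by (auto simp: P_def)
    have gF: "left_regular G (inv g) \<in> F" and hF: "left_regular G h \<in> F"
      using p by (auto simp: F_def)
    have M: "left_regular G (inv g) \<in> ?M" "left_regular G h \<in> ?M"
      using p Cc by (auto intro: left_regular_in_group_vna[OF GG])
    have "?N (cutoff (B p) \<nu>) \<le> ?N (cutoff H (left_regular G g (v (delta h))))"
      using cutoff_norm_le_mixing_coefficient[OF H vA] p Cc by (simp add: B_def \<nu>_def)
    also have "\<dots> \<le> \<epsilon>"
      using small[rule_format, OF gF hF] mixing_norm_eq[OF H comm M vU] p Cc
      by (simp add: left_regular_adj left_regular_delta)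
    finally show ?thesis .
  qed
  have "1 = ?N \<nu>"
    by (simp add: \<nu>_def unitary_vector_norm[OF H vU])
  also have "\<dots> \<le> ?N (\<lambda>\<gamma>. \<Sum>p\<in>P. cutoff (B p) \<nu> \<gamma>)"
  proof (rule ell2_norm_mono)
    show "(\<lambda>\<gamma>. \<Sum>p\<in>P. cutoff (B p) \<nu> \<gamma>) \<in> ell2 (carrier G)"
      by (intro ell2_sum_closed ell2_cutoff \<nu>)
    fix \<gamma>
    show "cmod (\<nu> \<gamma>) \<le> cmod (\<Sum>p\<in>P. cutoff (B p) \<nu> \<gamma>)"
    proof (cases "\<gamma> \<in> H")
      case True
      have "(\<Sum>p\<in>P. cutoff (B p) \<nu> \<gamma>) = of_nat (card {p \<in> P. \<gamma> \<in> B p}) * \<nu> \<gamma>"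
      proof -
        have "(\<Sum>p\<in>P. cutoff (B p) \<nu> \<gamma>) = (\<Sum>p\<in>{p \<in> P. \<gamma> \<in> B p}. \<nu> \<gamma>)"
          unfolding cutoff_def by (rule sum.inter_filter[OF P, symmetric])
        then show ?thesis by simp
      qed
      moreover have "{p \<in> P. \<gamma> \<in> B p} \<noteq> {}"
        using bspec[OF hit True] by (auto simp: P_def B_def)
      then have "1 \<le> card {p \<in> P. \<gamma> \<in> B p}"
        using P by (simp add: Suc_le_eq card_gt_0_iff)
      then have "1 * cmod (\<nu> \<gamma>) \<le> real (card {p \<in> P. \<gamma> \<in> B p}) * cmod (\<nu> \<gamma>)"
        by (intro mult_right_mono) auto
      ultimately show ?thesis
        by (simp add: norm_mult)
    qed (simp add: \<nu>_supp)
  qed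
  also have "\<dots> \<le> (\<Sum>p\<in>P. ?N (cutoff (B p) \<nu>))"
    by (intro ell2_norm_sum_le ell2_cutoff \<nu>)
  also have "\<dots> \<le> (\<Sum>p\<in>P. \<epsilon>)"
    by (rule sum_mono) (rule piece)
  also have "\<dots> < 1"
    by (simp add: \<epsilon>_def)
  finally show False by simp
qed

end

theorem proposition2p3:
  fixes \<Gamma> :: "('a, 'b) monoid_scheme" and \<Gamma>\<^sub>0 :: "'a set"
  assumes "group \<Gamma>"
    and "countable (carrier \<Gamma>)"
    and "subgroup \<Gamma>\<^sub>0 \<Gamma>"
    and "comm_group (\<Gamma>\<lparr>carrier := \<Gamma>\<^sub>0\<rparr>)"
  shows "condition_SS \<Gamma> \<Gamma>\<^sub>0 \<longleftrightarrow>
    weakly_mixing (carrier \<Gamma>) (group_trace \<Gamma>)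
      (group_vna \<Gamma> (carrier \<Gamma>)) (group_vna \<Gamma> \<Gamma>\<^sub>0)"
proof -
  interpret group \<Gamma> by fact
  note H = assms(3)
  have comm: "g \<otimes>\<^bsub>\<Gamma>\<^esub> h = h \<otimes>\<^bsub>\<Gamma>\<^esub> g" if "g \<in> \<Gamma>\<^sub>0" "h \<in> \<Gamma>\<^sub>0" for g h
    using comm_monoid.m_comm[OF comm_group.axioms(1)[OF assms(4)], of g h] that by simp
  show ?thesis
  proof
    assume "condition_SS \<Gamma> \<Gamma>\<^sub>0"
    note mixing = SS_imp_weakly_mixing_action[OF H comm this]
    show "weakly_mixing (carrier \<Gamma>) (group_trace \<Gamma>)
        (group_vna \<Gamma> (carrier \<Gamma>)) (group_vna \<Gamma> \<Gamma>\<^sub>0)"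
      unfolding weakly_mixing_def
      by (intro conjI ballI exI[of _ "left_regular \<Gamma> ` \<Gamma>\<^sub>0"] group_vna_vna subgroup_self H
          group_vna_mono subgroup.subset[OF H] group_vna_commute[OF H comm]
          left_regular_subgroup mixing)
  next
    assume "weakly_mixing (carrier \<Gamma>) (group_trace \<Gamma>)
        (group_vna \<Gamma> (carrier \<Gamma>)) (group_vna \<Gamma> \<Gamma>\<^sub>0)"
    then obtain V where V: "subgroup V (unitary_group (carrier \<Gamma>) (group_vna \<Gamma> \<Gamma>\<^sub>0))"
      and wm: "weakly_mixing_action (carrier \<Gamma>) (group_trace \<Gamma>)
        (group_vna \<Gamma> (carrier \<Gamma>)) (group_vna \<Gamma> \<Gamma>\<^sub>0) V"
      unfolding weakly_mixing_def by (elim conjE exE)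
    show "condition_SS \<Gamma> \<Gamma>\<^sub>0"
      by (rule weakly_mixing_action_imp_SS[OF H comm subgroup.subset[OF V] wm])
  qed
qed

end
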